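(* Let $B=B(F_n)$ be a generalized Bratteli diagram having the equal row sums property with parameters $(r_n)_{n\ge0}$, i.e. $\sum_{w\in V_n}f^{(n)}_{v,w}=r_n$ for all $n\in\mathbb N_0$ and all $v\in V_{n+1}$. Let $\overline B=B(W_n)$ be a vertex subdiagram of $B$ with finite sets $W_n\subset V_n$ that is a simple standard Bratteli diagram. If the set $\{M'_n/m'_n:n\in\mathbb N\}$ is bounded and the (finite) limit $$\lim_{n\to\infty}\prod_{i=0}^n\frac{r_i}{\overline m_i|W_i|}$$ exists, then for every probability tail invariant measure $\nu$ on $X_{\overline B}$ the measure extension $\widehat\nu(\widehat X_{\overline B})$ is finite.
   Context: A generalized Bratteli diagram is a graded graph $B=(V,E)$, $V=\bigsqcup_{n\ge0}V_n$, $E=\bigsqcup_{n\ge0}E_n$, with each $V_n$ countably infinite and each $E_n$ countable; every $e\in E_n$ has a source $s(e)\in V_n$ and a range $r(e)\in V_{n+1}$; $s^{-1}(v)\ne\emptyset$ for all $v\in V$; $r^{-1}(v)$ is nonempty and finite for all $v\in V\setminus V_0$. If instead every $V_n$ is finite, the diagram is called standard. The incidence matrix $F_n=(f^{(n)}_{v,w})_{v\in V_{n+1},w\in V_n}$ counts the edges between $w$ and $v$. The path space $X_B$ is the set of infinite sequences $(x_n)$, $x_n\in E_n$, $r(x_n)=s(x_{n+1})$, with the topology generated by cylinder sets of finite paths starting in $V_0$. Two paths are tail equivalent (relation $\mathcal R$) if they agree from some index on. A tail invariant measure is a non-atomic positive Borel measure giving equal value to cylinder sets $[\overline e]$, $[\overline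 e']$ whenever $\overline e,\overline e'$ are finite paths from $V_0$ to the same vertex. Vertex subdiagram $B(W_n)$: vertex sets $W_n\subsetneq V_n$ and all edges of $B$ with source in $W_n$ and range in $W_{n+1}$. Simplicity of $\overline B$ is used in the form (after telescoping): $f^{(n)}_{v,w}>0$ for all $w\in W_n$, $v\in W_{n+1}$, $n\in\mathbb N_0$. Notation: $\overline m_n=\min\{f^{(n)}_{v,w}:v\in W_{n+1},w\in W_n\}$. $W'_n$ denotes the finite set of vertices $w\in V_n\setminus W_n$ with $f^{(n)}_{v,w}>0$ for some $v\in W_{n+1}$; $M'_n=\max\{f^{(n)}_{v,w}:v\in W_{n+1},w\in W'_n\}$ and $m'_n=\min\{f^{(n)}_{v,w}:v\in W_{n+1},w\in W'_n\}$; the ratios are understood to be defined, i.e. $W'_n\neq\emptyset$ and $m'_n>0$. Measure extension: $\widehat X_{\overline B}\subset X_B$ is the set of all paths of $X_B$ tail equivalent (in $B$) to some path of $X_{\overline B}$; $\widehat\nu$ is the unique $\mathcal R$-invariant Borel measure (possibly infinite) on $\widehat X_{\overline B}$ extending $\nu$: for a finite path $f$ of $B$ from $V_0$ to $v\in W_n$, the set of paths that begin with $f$ and whose edges after $f$ all lie in $\overline B$ has $\widehat\nu$-measure equal to the $\nu$-measure of a cylinder set of $X_{\overline B}$ ending at $v$. *)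

theory Defs
  imports "HOL-Probability.Probability"
begin

record ('v, 'e) diagram =
  vertices :: "nat \<Rightarrow> 'v set"
  edges :: "nat \<Rightarrow> 'e set"
  src :: "'e \<Rightarrow> 'v"
  rng :: "'e \<Rightarrow> 'v"

definition bratteli_diagram :: "('v, 'e) diagram \<Rightarrow> bool" where
  "bratteli_diagram B \<longleftrightarrow>
     disjoint_family (vertices B) \<and> disjoint_family (edges B) \<and>
     (\<forall>n. \<forall>e \<in> edges B n. src B e \<in> vertices B n \<and> rng B e \<in> vertices B (Suc n)) \<and>
     (\<forall>n. \<forall>v \<in> vertices B n. {e \<in> edges B n. src B e = v} \<noteq> {}) \<and>
     (\<forall>n. \<forall>v \<in> vertices B (Suc n).
        {e \<in> edges B n. rng B e = v} \<noteq> {} \<and> finite {e \<in> edges B n. rng B e = v})"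

definition generalized_bratteli_diagram :: "('v, 'e) diagram \<Rightarrow> bool" where
  "generalized_bratteli_diagram B \<longleftrightarrow>
     bratteli_diagram B \<and>
     (\<forall>n. countable (vertices B n) \<and> infinite (vertices B n) \<and> countable (edges B n))"

definition standard_bratteli_diagram :: "('v, 'e) diagram \<Rightarrow> bool" where
  "standard_bratteli_diagram B \<longleftrightarrow> bratteli_diagram B \<and> (\<forall>n. finite (vertices B n))"

(* The entry f^(n)_{v,w}: the number of edges from w in V_n to v in V_{n+1}. *)
definition incidence :: "('v, 'e) diagram \<Rightarrow> nat \<Rightarrow> 'v \<Rightarrow> 'v \<Rightarrow> nat" where
  "incidence B n v w = card {e \<in> edges B n. src B e = w \<and> rng B e = v}"

definition equal_row_sums :: "('v, 'e) diagram \<Rightarrow> (nat \<Rightarrow> nat) \<Rightarrow> bool" where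
  "equal_row_sums B r \<longleftrightarrow>
     (\<forall>n. \<forall>v \<in> vertices B (Suc n). ((\<lambda>w. incidence B n v w) has_sum r n) (vertices B n))"

(* Simplicity in the form it takes after telescoping: all entries of all incidence
   matrices are positive. *)
definition simple_diagram :: "('v, 'e) diagram \<Rightarrow> bool" where
  "simple_diagram B \<longleftrightarrow>
     (\<forall>n. \<forall>w \<in> vertices B n. \<forall>v \<in> vertices B (Suc n). incidence B n v w > 0)"

definition vertex_subdiagram :: "('v, 'e) diagram \<Rightarrow> (nat \<Rightarrow> 'v set) \<Rightarrow> ('v, 'e) diagram" where
  "vertex_subdiagram B W =
     B\<lparr>vertices := W,
       edges := (\<lambda>n. {e \<in> edges B n. src B e \<in> W n \<and> rng B e \<in> W (Suc n)})\<rparr>"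

definition m_bar :: "('v, 'e) diagram \<Rightarrow> (nat \<Rightarrow> 'v set) \<Rightarrow> nat \<Rightarrow> nat" where
  "m_bar B W n = Min {incidence B n v w | v w. v \<in> W (Suc n) \<and> w \<in> W n}"

definition W_prime :: "('v, 'e) diagram \<Rightarrow> (nat \<Rightarrow> 'v set) \<Rightarrow> nat \<Rightarrow> 'v set" where
  "W_prime B W n = {w \<in> vertices B n - W n. \<exists>v \<in> W (Suc n). incidence B n v w > 0}"

definition M_prime :: "('v, 'e) diagram \<Rightarrow> (nat \<Rightarrow> 'v set) \<Rightarrow> nat \<Rightarrow> nat" where
  "M_prime B W n = Max {incidence B n v w | v w. v \<in> W (Suc n) \<and> w \<in> W_prime B W n}"

definition m_prime :: "('v, 'e) diagram \<Rightarrow> (nat \<Rightarrow> 'v set) \<Rightarrow> nat \<Rightarrow> nat" where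
  "m_prime B W n = Min {incidence B n v w | v w. v \<in> W (Suc n) \<and> w \<in> W_prime B W n}"

definition path_space :: "('v, 'e) diagram \<Rightarrow> (nat \<Rightarrow> 'e) set" where
  "path_space B = {x. \<forall>n. x n \<in> edges B n \<and> rng B (x n) = src B (x (Suc n))}"

(* walk B n v p w: the edge list p, with first edge in E_n, leads from v to w. *)
primrec walk :: "('v, 'e) diagram \<Rightarrow> nat \<Rightarrow> 'v \<Rightarrow> 'e list \<Rightarrow> 'v \<Rightarrow> bool" where
  "walk B n v [] w \<longleftrightarrow> v = w"
| "walk B n v (e # p) w \<longleftrightarrow> e \<in> edges B n \<and> src B e = v \<and> walk B (Suc n) (rng B e) p w"

(* The initial vertex u is recorded in addition to the edges so that the paths of length
   zero at the vertices of V_0 are included. *)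
definition finite_path :: "('v, 'e) diagram \<Rightarrow> 'v \<Rightarrow> 'e list \<Rightarrow> 'v \<Rightarrow> bool" where
  "finite_path B u p v \<longleftrightarrow> u \<in> vertices B 0 \<and> walk B 0 u p v"

definition cylinder :: "('v, 'e) diagram \<Rightarrow> 'v \<Rightarrow> 'e list \<Rightarrow> (nat \<Rightarrow> 'e) set" where
  "cylinder B u p = {x \<in> path_space B. src B (x 0) = u \<and> (\<forall>i < length p. x i = p ! i)}"

definition path_topology :: "('v, 'e) diagram \<Rightarrow> (nat \<Rightarrow> 'e) topology" where
  "path_topology B = topology_generated_by {cylinder B u p | u p v. finite_path B u p v}"

definition tail_equivalent :: "(nat \<Rightarrow> 'e) \<Rightarrow> (nat \<Rightarrow> 'e) \<Rightarrow> bool" where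
  "tail_equivalent x y \<longleftrightarrow> (\<exists>N. \<forall>n \<ge> N. x n = y n)"

definition borel_measure_on :: "'a topology \<Rightarrow> 'a measure \<Rightarrow> bool" where
  "borel_measure_on T M \<longleftrightarrow>
     space M = topspace T \<and> sets M = sigma_sets (topspace T) {U. openin T U}"

definition nonatomic :: "'a measure \<Rightarrow> bool" where
  "nonatomic M \<longleftrightarrow>
     (\<forall>A \<in> sets M. 0 < emeasure M A \<longrightarrow>
        (\<exists>A' \<in> sets M. A' \<subseteq> A \<and> 0 < emeasure M A' \<and> emeasure M A' < emeasure M A))"

(* Invariance under tail equivalence. The intersection with the space of M matters only for
   measures living on a tail invariant subset of the path space. *)
definition tail_invariant :: "('v, 'e) diagram \<Rightarrow> (nat \<Rightarrow> 'e) measure \<Rightarrow> bool" where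
  "tail_invariant B M \<longleftrightarrow>
     (\<forall>u p u' p' v. finite_path B u p v \<and> finite_path B u' p' v \<longrightarrow>
        emeasure M (cylinder B u p \<inter> space M) = emeasure M (cylinder B u' p' \<inter> space M))"

definition tail_invariant_measure :: "('v, 'e) diagram \<Rightarrow> (nat \<Rightarrow> 'e) measure \<Rightarrow> bool" where
  "tail_invariant_measure B M \<longleftrightarrow>
     borel_measure_on (path_topology B) M \<and> nonatomic M \<and> tail_invariant B M"

(* The saturation of the path space of the subdiagram B' in the path space of B. *)
definition extension_space :: "('v, 'e) diagram \<Rightarrow> ('v, 'e) diagram \<Rightarrow> (nat \<Rightarrow> 'e) set" where
  "extension_space B B' = {x \<in> path_space B. \<exists>y \<in> path_space B'. tail_equivalent x y}"

definition is_measure_extension ::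
  "('v, 'e) diagram \<Rightarrow> ('v, 'e) diagram \<Rightarrow> (nat \<Rightarrow> 'e) measure \<Rightarrow> (nat \<Rightarrow> 'e) measure \<Rightarrow> bool" where
  "is_measure_extension B B' \<nu> M \<longleftrightarrow>
     borel_measure_on (subtopology (path_topology B) (extension_space B B')) M \<and>
     tail_invariant B M \<and>
     (\<forall>A \<in> sets \<nu>. emeasure M A = emeasure \<nu> A) \<and>
     (\<forall>u p u' p' v. finite_path B u p v \<and> finite_path B' u' p' v \<longrightarrow>
        emeasure M {x \<in> cylinder B u p. \<forall>i \<ge> length p. x i \<in> edges B' i} =
        emeasure \<nu> (cylinder B' u' p'))"

definition measure_extension ::
  "('v, 'e) diagram \<Rightarrow> ('v, 'e) diagram \<Rightarrow> (nat \<Rightarrow> 'e) measure \<Rightarrow> (nat \<Rightarrow> 'e) measure" where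
  "measure_extension B B' \<nu> = (THE M. is_measure_extension B B' \<nu> M)"

end

theory Submission
  imports Defs
begin

text \<open>The extension is built explicitly: a path in the extension space is a minimal finite path of \<open>B\<close>
  into the subdiagram followed by a path of the subdiagram, so the extension is an image of the
  product of the counting measure on minimal paths with \<open>\<nu>\<close>. Uniqueness follows since the sets of
  paths that follow a given finite path and then stay in the subdiagram form a countable laminar
  family generating the Borel sets. The paths that stay in the subdiagram from level \<open>n\<close> on have
  measure \<open>\<Prod>i<n. r i\<close> times the sum over \<open>v \<in> W n\<close> of the common measure of the cylinders ending
  at \<open>v\<close>. At least \<open>\<Prod>i<n. m_bar i * card (W i)\<close> disjoint cylinders of the subdiagram end at each such
  \<open>v\<close>, so this is at most the \<open>n\<close>-th partial product of the ratios, which is bounded.\<close>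

section \<open>Walks and finite paths of a Bratteli diagram\<close>

lemma bratteli_diagramD:
  assumes "bratteli_diagram B"
  shows "disjoint_family (vertices B)" "disjoint_family (edges B)"
    and "e \<in> edges B n \<Longrightarrow> src B e \<in> vertices B n"
    and "e \<in> edges B n \<Longrightarrow> rng B e \<in> vertices B (Suc n)"
    and "v \<in> vertices B (Suc n) \<Longrightarrow> \<exists>e \<in> edges B n. rng B e = v"
    and "v \<in> vertices B (Suc n) \<Longrightarrow> finite {e \<in> edges B n. rng B e = v}"
  using assms unfolding bratteli_diagram_def by blast+

lemma walk_append:
  "walk B n v (p @ q) w \<longleftrightarrow> (\<exists>z. walk B n v p z \<and> walk B (n + length p) z q w)"
  by (induction p arbitrary: n v) auto

lemma walk_endpoint_unique: "walk B n v p w \<Longrightarrow> walk B n v p w' \<Longrightarrow> w = w'"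
  by (induction p arbitrary: n v) auto

lemma walk_nth:
  assumes "walk B n v p w" "i < length p"
  shows "p ! i \<in> edges B (n + i)"
    and "src B (p ! i) = (if i = 0 then v else rng B (p ! (i - 1)))"
    and "rng B (p ! i) = (if Suc i = length p then w else src B (p ! Suc i))"
  using assms
proof (induction p arbitrary: n v i)
  case (Cons e p)
  {
    case 1
    then show ?case using Cons.IH(1)[of "Suc n" "rng B e" "i - 1"] by (cases i) auto
  next
    case 2
    then show ?case using Cons.IH(2)[of "Suc n" "rng B e" "i - 1"]
      by (cases i) (auto simp: nth_Cons')
  next
    case 3
    then show ?case using Cons.IH(3)[of "Suc n" "rng B e" "i - 1"]
      by (cases i; cases p) auto
  }
qed auto

lemma walk_vertex:
  assumes "bratteli_diagram B" "v \<in> vertices B n" "walk B n v p w"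
  shows "w \<in> vertices B (n + length p)"
  using assms(2,3)
proof (induction p arbitrary: n v)
  case (Cons e p)
  from Cons.IH[of "rng B e" "Suc n"] Cons.prems show ?case
    using bratteli_diagramD(4)[OF assms(1)] by auto
qed auto

lemma finite_path_vertex:
  assumes "bratteli_diagram B" "finite_path B u p v"
  shows "v \<in> vertices B (length p)"
  using walk_vertex[OF assms(1), of u 0 p v] assms(2) by (simp add: finite_path_def)

text \<open>Vertex sets of different levels are disjoint, so the endpoint fixes the level and with
  it the number of edges.\<close>

lemma finite_path_length_unique:
  assumes "bratteli_diagram B" "finite_path B u p v" "finite_path B u' p' v"
  shows "length p = length p'"
  using finite_path_vertex[OF assms(1,2)] finite_path_vertex[OF assms(1,3)]
    disjoint_family_onD[OF bratteli_diagramD(1)[OF assms(1)]] by blast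

lemma finite_path_append:
  "finite_path B u (p @ q) w \<longleftrightarrow> (\<exists>v. finite_path B u p v \<and> walk B (length p) v q w)"
  by (auto simp: finite_path_def walk_append)

text \<open>Every vertex above level zero has an incoming edge, so a path can be traced back from
  \<open>v\<close> to level zero. Applied to the subdiagram, this supplies initial segments inside
  it.\<close>

lemma finite_path_exists:
  assumes "bratteli_diagram B" "v \<in> vertices B n"
  shows "\<exists>u p. finite_path B u p v \<and> length p = n"
  using assms(2)
proof (induction n arbitrary: v)
  case 0
  then show ?case by (intro exI[of _ v] exI[of _ "[]"]) (simp add: finite_path_def)
next
  case (Suc n)
  from bratteli_diagramD(5)[OF assms(1) Suc.prems] obtain e
    where e: "e \<in> edges B n" "rng B e = v" by blast
  from Suc.IH[OF bratteli_diagramD(3)[OF assms(1) e(1)]] obtain u p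
    where p: "finite_path B u p (src B e)" "length p = n" by blast
  then have "finite_path B u (p @ [e]) v" using e by (auto simp: finite_path_append)
  with p(2) show ?case by (intro exI[of _ u] exI[of _ "p @ [e]"]) simp
qed

section \<open>Infinite paths, cylinders and the path topology\<close>

lemma path_spaceD:
  assumes "x \<in> path_space B"
  shows "x n \<in> edges B n" "rng B (x n) = src B (x (Suc n))"
  using assms by (auto simp: path_space_def)

lemma walk_path:
  assumes "x \<in> path_space B"
  shows "walk B n (src B (x n)) (map x [n..<n + k]) (src B (x (n + k)))"
proof (induction k)
  case (Suc k)
  then show ?case using path_spaceD[OF assms, of "n + k"] by (auto simp: walk_append)
qed simp

lemma finite_path_path:
  assumes "bratteli_diagram B" "x \<in> path_space B"
  shows "finite_path B (src B (x 0)) (map x [0..<n]) (src B (x n))"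
  using walk_path[OF assms(2), of 0 n] bratteli_diagramD(3)[OF assms(1) path_spaceD(1)[OF assms(2)]]
  by (simp add: finite_path_def)

lemma cylinder_subset_path_space: "cylinder B u p \<subseteq> path_space B"
  by (auto simp: cylinder_def)

text \<open>A single member \<open>x\<close> determines start, edges and endpoint of the finite path
  once its length is known; the disjointness of tail cylinders of equal length rests on
  this.\<close>

lemma cylinderD:
  assumes "finite_path B u p v" "x \<in> cylinder B u p"
  shows "u = src B (x 0)" "p = map x [0..<length p]" "v = src B (x (length p))"
proof -
  from assms(2) show u: "u = src B (x 0)" by (simp add: cylinder_def)
  from assms(2) show p: "p = map x [0..<length p]" by (intro nth_equalityI) (auto simp: cylinder_def)
  have "walk B 0 u p (src B (x (length p)))"
    using walk_path[of x B 0 "length p"] assms(2) by (simp add: cylinder_def p[symmetric])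
  with assms(1) show "v = src B (x (length p))"
    by (auto simp: finite_path_def intro: walk_endpoint_unique)
qed

lemma mem_cylinder_path:
  assumes "x \<in> path_space B"
  shows "x \<in> cylinder B (src B (x 0)) (map x [0..<n])"
  using assms by (simp add: cylinder_def)

lemma cylinder_path_antimono:
  assumes "m \<le> n"
  shows "cylinder B u (map x [0..<n]) \<subseteq> cylinder B u (map x [0..<m])"
  using assms by (auto simp: cylinder_def)

text \<open>The entries of \<open>p\<close> overwrite those of \<open>x\<close> instead of being
  prepended: the entry at index \<open>i\<close> has to remain an edge of level
  \<open>i\<close>.\<close>

definition graft :: "'e list \<Rightarrow> (nat \<Rightarrow> 'e) \<Rightarrow> nat \<Rightarrow> 'e" where
  "graft p x = (\<lambda>i. if i < length p then p ! i else x i)"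

text \<open>Only the entries of \<open>x\<close> from index \<open>length p\<close> on survive, so
  only they are constrained. This allows a path of \<open>B\<close> to be completed to a path of the
  subdiagram.\<close>

lemma graft_mem_cylinder:
  assumes "finite_path B u p v" "src B (x (length p)) = v"
    and "\<And>i. i \<ge> length p \<Longrightarrow> x i \<in> edges B i \<and> rng B (x i) = src B (x (Suc i))"
  shows "graft p x \<in> cylinder B u p"
proof -
  have w: "walk B 0 u p v" using assms(1) by (simp add: finite_path_def)
  have "graft p x \<in> path_space B"
    unfolding path_space_def
  proof (safe)
    fix n
    show "graft p x n \<in> edges B n"
      using walk_nth(1)[OF w, of n] assms(3)[of n] by (auto simp: graft_def)
    \<comment> \<open>The seam is at \<open>Suc n = length p\<close>, where the last edge of
      \<open>p\<close> ends in \<open>v\<close> and \<open>x\<close> continues from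
      \<open>v\<close>.\<close>
    show "rng B (graft p x n) = src B (graft p x (Suc n))"
      using walk_nth(3)[OF w, of n] assms(2) assms(3)[of n]
      by (cases "Suc n = length p"; cases "Suc n < length p") (auto simp: graft_def)
  qed
  moreover have "src B (graft p x 0) = u"
    using walk_nth(2)[OF w, of 0] w assms(2) by (cases p) (auto simp: graft_def)
  ultimately show ?thesis by (auto simp: cylinder_def graft_def)
qed

lemma topspace_path_topology:
  assumes "bratteli_diagram B"
  shows "topspace (path_topology B) = path_space B"
proof -
  have "x \<in> \<Union> {cylinder B u p | u p v. finite_path B u p v}" if "x \<in> path_space B" for x
  proof
    show "cylinder B (src B (x 0)) (map x [0..<0]) \<in> {cylinder B u p | u p v. finite_path B u p v}"
      using finite_path_path[OF assms that, of 0] by blast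
  qed (rule mem_cylinder_path[OF that])
  then show ?thesis
    unfolding path_topology_def topology_generated_by_topspace
    by (auto simp: cylinder_def)
qed

lemma openin_path_topology_cylinder:
  "finite_path B u p v \<Longrightarrow> openin (path_topology B) (cylinder B u p)"
  unfolding path_topology_def by (rule topology_generated_by_Basis) blast

text \<open>The cylinders along \<open>x\<close> decrease with \<open>n\<close>, so for an
  intersection of two generated sets the longer of the two prefixes serves. A basic cylinder that
  contains \<open>x\<close> is itself a cylinder along \<open>x\<close>.\<close>

lemma openin_path_topology_nbhd:
  assumes "openin (path_topology B) U" "x \<in> U"
  shows "\<exists>n. cylinder B (src B (x 0)) (map x [0..<n]) \<subseteq> U"
proof -
  have "generate_topology_on {cylinder B u p | u p v. finite_path B u p v} U"
    using assms(1) unfolding path_topology_def openin_topology_generated_by_iff .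
  then show ?thesis using assms(2)
  proof (induction rule: generate_topology_on.induct)
    case (Int U V)
    then obtain m n where
      "cylinder B (src B (x 0)) (map x [0..<m]) \<subseteq> U" "cylinder B (src B (x 0)) (map x [0..<n]) \<subseteq> V"
      by blast
    then have "cylinder B (src B (x 0)) (map x [0..<max m n]) \<subseteq> U \<inter> V"
      using cylinder_path_antimono[of m "max m n" B "src B (x 0)" x]
        cylinder_path_antimono[of n "max m n" B "src B (x 0)" x] by auto
    then show ?case by blast
  next
    case (UN K)
    then show ?case by blast
  next
    case (Basis U)
    then obtain u p v where p: "finite_path B u p v" "U = cylinder B u p" by blast
    from Basis.prems p(2) have x: "x \<in> cylinder B u p" by simp
    have "cylinder B (src B (x 0)) (map x [0..<length p]) = U"
      unfolding cylinderD(1,2)[OF p(1) x, symmetric] by (rule p(2)[symmetric])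
    then show ?case by blast
  qed auto
qed

text \<open>Start, edge list and endpoint each come from a countable set; the condition on
  \<open>v\<close> provides this for the endpoint without the diagram axioms.\<close>

lemma countable_finite_paths:
  assumes "\<And>n. countable (vertices B n)" "\<And>n. countable (edges B n)"
  shows "countable {(u, p, v). finite_path B u p v \<and> v \<in> vertices B (length p)}"
proof (rule countable_subset)
  show "{(u, p, v). finite_path B u p v \<and> v \<in> vertices B (length p)}
      \<subseteq> vertices B 0 \<times> lists (\<Union>n. edges B n) \<times> (\<Union>n. vertices B n)"
  proof -
    have "p \<in> lists (\<Union>n. edges B n)" if "finite_path B u p v" for u p v
    proof (intro in_listsI ballI)
      fix e assume "e \<in> set p"
      then obtain i where "i < length p" "e = p ! i" by (auto simp: in_set_conv_nth)
      with that show "e \<in> (\<Union>n. edges B n)"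
        using walk_nth(1)[of B 0 u p v i] by (auto simp: finite_path_def)
    qed
    then show ?thesis by (force simp: finite_path_def simp del: in_lists_conv_set)
  qed
  show "countable (vertices B 0 \<times> lists (\<Union>n. edges B n) \<times> (\<Union>n. vertices B n))"
    using assms by (intro countable_SIGMA countable_lists countable_UN) auto
qed

section \<open>The extension space and its generating family of tail cylinders\<close>

locale bratteli_pair =
  fixes B :: "('v, 'e) diagram" and W :: "nat \<Rightarrow> 'v set"
  assumes generalized: "generalized_bratteli_diagram B"
    and W_subset: "W n \<subseteq> vertices B n"
    and sub: "bratteli_diagram (vertex_subdiagram B W)"
begin

abbreviation "S \<equiv> vertex_subdiagram B W"
abbreviation "X \<equiv> extension_space B S"

lemma diagram: "bratteli_diagram B"
  using generalized by (simp add: generalized_bratteli_diagram_def)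

lemma sub_simps [simp]: "vertices S = W" "src S = src B" "rng S = rng B"
  by (simp_all add: vertex_subdiagram_def)

lemma edges_sub: "e \<in> edges S n \<longleftrightarrow> e \<in> edges B n \<and> src B e \<in> W n \<and> rng B e \<in> W (Suc n)"
  by (simp add: vertex_subdiagram_def)

lemma path_space_sub: "x \<in> path_space S \<longleftrightarrow> x \<in> path_space B \<and> (\<forall>i. x i \<in> edges S i)"
  by (auto simp: path_space_def edges_sub)

text \<open>A path of \<open>B\<close> that runs in \<open>S\<close> from level \<open>n\<close> on
  sits there at a vertex of \<open>W n\<close>, to which some path of \<open>S\<close> leads from
  level zero; grafting that path gives a tail equivalent path of \<open>S\<close>. Tail equivalence
  thus becomes a condition on \<open>x\<close> alone.\<close>

lemma extension_space_iff:
  "x \<in> X \<longleftrightarrow> x \<in> path_space B \<and> (\<exists>n. \<forall>i\<ge>n. x i \<in> edges S i)"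
proof
  assume "x \<in> X"
  then obtain y n where "x \<in> path_space B" "y \<in> path_space S" "\<forall>i\<ge>n. x i = y i"
    unfolding extension_space_def tail_equivalent_def by blast
  then show "x \<in> path_space B \<and> (\<exists>n. \<forall>i\<ge>n. x i \<in> edges S i)"
    by (auto simp: path_space_sub intro!: exI[of _ n])
next
  assume "x \<in> path_space B \<and> (\<exists>n. \<forall>i\<ge>n. x i \<in> edges S i)"
  then obtain n where x: "x \<in> path_space B" and tail: "\<And>i. i \<ge> n \<Longrightarrow> x i \<in> edges S i" by blast
  have "src B (x n) \<in> vertices S n" using tail[of n] by (simp add: edges_sub)
  then obtain u p where p: "finite_path S u p (src B (x n))" "length p = n"
    using finite_path_exists[OF sub] by blast
  have "graft p x \<in> cylinder S u p"
    using p tail path_spaceD(2)[OF x] by (intro graft_mem_cylinder) auto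
  moreover have "tail_equivalent x (graft p x)"
    unfolding tail_equivalent_def graft_def using p(2) by (intro exI[of _ n]) simp
  ultimately show "x \<in> X"
    using x cylinder_subset_path_space[of S u p] by (auto simp: extension_space_def)
qed

text \<open>For paths \<open>p\<close> ending in \<open>W\<close> these are the sets whose measure
  the definition of the extension prescribes.\<close>

definition tail_cylinder :: "'v \<Rightarrow> 'e list \<Rightarrow> (nat \<Rightarrow> 'e) set" where
  "tail_cylinder u p = {x \<in> cylinder B u p. \<forall>i \<ge> length p. x i \<in> edges S i}"

lemma tail_cylinder_subset: "tail_cylinder u p \<subseteq> cylinder B u p"
  by (auto simp: tail_cylinder_def)

lemma tail_cylinder_subset_space: "tail_cylinder u p \<subseteq> X"
proof
  fix x assume "x \<in> tail_cylinder u p"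
  then show "x \<in> X"
    unfolding extension_space_iff by (intro conjI exI[of _ "length p"]) (auto simp: tail_cylinder_def cylinder_def)
qed

lemma mem_tail_cylinder_path:
  assumes "x \<in> path_space B" "\<And>i. i \<ge> n \<Longrightarrow> x i \<in> edges S i"
  shows "x \<in> tail_cylinder (src B (x 0)) (map x [0..<n])"
  using assms mem_cylinder_path[of x B n] by (auto simp: tail_cylinder_def)

text \<open>The common point \<open>x\<close> begins with both finite paths, so \<open>p'\<close>
  begins with \<open>p\<close> and its further edges lie in \<open>S\<close>. Hence two tail
  cylinders are disjoint or nested.\<close>

lemma tail_cylinder_nested:
  assumes "length p \<le> length p'" "x \<in> tail_cylinder u p" "x \<in> tail_cylinder u' p'"
  shows "tail_cylinder u' p' \<subseteq> tail_cylinder u p"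
proof
  fix y assume y: "y \<in> tail_cylinder u' p'"
  have eq: "y i = x i" if "i < length p'" for i
    using y assms(3) that by (auto simp: tail_cylinder_def cylinder_def)
  have "y i \<in> edges S i" if "i \<ge> length p" for i
    using eq[of i] assms(2) y that by (cases "i < length p'") (auto simp: tail_cylinder_def)
  moreover have "y i = p ! i" if "i < length p" for i
    using eq[of i] assms(1,2) that by (auto simp: tail_cylinder_def cylinder_def)
  moreover have "src B (y 0) = u" "y \<in> path_space B"
    using assms(2,3) y by (auto simp: tail_cylinder_def cylinder_def)
  ultimately show "y \<in> tail_cylinder u p" by (auto simp: tail_cylinder_def cylinder_def)
qed

definition tail_cylinders :: "(nat \<Rightarrow> 'e) set set" where
  "tail_cylinders = {tail_cylinder u p | u p v. finite_path B u p v \<and> v \<in> W (length p)}"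

lemma tail_cylinders_subset: "insert {} tail_cylinders \<subseteq> Pow X"
  using tail_cylinder_subset_space by (auto simp: tail_cylinders_def)

lemma countable_tail_cylinders: "countable tail_cylinders"
proof (rule countable_subset)
  show "tail_cylinders \<subseteq> (\<lambda>(u, p, v). tail_cylinder u p) `
      {(u, p, v). finite_path B u p v \<and> v \<in> vertices B (length p)}"
    using W_subset by (force simp: tail_cylinders_def)
  show "countable ((\<lambda>(u, p, v). tail_cylinder u p) `
      {(u, p, v). finite_path B u p v \<and> v \<in> vertices B (length p)})"
    using generalized
    by (intro countable_image countable_finite_paths) (auto simp: generalized_bratteli_diagram_def)
qed

text \<open>Nestedness leaves the smaller set as the intersection unless the two are disjoint; for
  that case the empty set is adjoined to the generators.\<close>

lemma Int_stable_tail_cylinders: "Int_stable (insert {} tail_cylinders)"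
proof (rule Int_stableI)
  fix E F assume EF: "E \<in> insert {} tail_cylinders" "F \<in> insert {} tail_cylinders"
  show "E \<inter> F \<in> insert {} tail_cylinders"
  proof (cases "E \<inter> F = {}")
    case False
    then obtain x where x: "x \<in> E" "x \<in> F" by blast
    with EF obtain u p u' p' where "E = tail_cylinder u p" "F = tail_cylinder u' p'"
      by (auto simp: tail_cylinders_def)
    with x have "E \<subseteq> F \<or> F \<subseteq> E"
      using tail_cylinder_nested[of p p' x u u'] tail_cylinder_nested[of p' p x u' u]
      by (cases "length p \<le> length p'") auto
    then show ?thesis using EF by (auto simp: Int_absorb1 Int_absorb2)
  qed simp
qed

lemma mem_tail_cylinders_path:
  assumes "x \<in> path_space B" "\<And>i. i \<ge> n \<Longrightarrow> x i \<in> edges S i"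
  shows "tail_cylinder (src B (x 0)) (map x [0..<n]) \<in> tail_cylinders"
proof -
  have "src B (x n) \<in> W n" using assms(2)[of n] by (simp add: edges_sub)
  then show ?thesis
    using finite_path_path[OF diagram assms(1), of n]
    unfolding tail_cylinders_def by (intro CollectI exI conjI[OF refl]) auto
qed

lemma Union_tail_cylinders: "\<Union> tail_cylinders = X"
proof
  show "\<Union> tail_cylinders \<subseteq> X" using tail_cylinders_subset by auto
  show "X \<subseteq> \<Union> tail_cylinders"
  proof
    fix x assume "x \<in> X"
    then obtain n where "x \<in> path_space B" "\<And>i. i \<ge> n \<Longrightarrow> x i \<in> edges S i"
      by (auto simp: extension_space_iff)
    then show "x \<in> \<Union> tail_cylinders"
      using mem_tail_cylinder_path mem_tail_cylinders_path by blast
  qed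
qed

lemma topspace_extension: "topspace (subtopology (path_topology B) X) = X"
  using topspace_path_topology[OF diagram] by (auto simp: extension_space_def)

text \<open>There are only countably many tail cylinders, so any union of them is a countable
  one.\<close>

lemma sigma_sets_Union_tail_cylinders:
  assumes "\<And>x. x \<in> U \<Longrightarrow> \<exists>E \<in> tail_cylinders. x \<in> E \<and> E \<subseteq> U"
  shows "U \<in> sigma_sets X (insert {} tail_cylinders)"
proof -
  have "U = \<Union> {E \<in> tail_cylinders. E \<subseteq> U}" using assms by blast
  moreover have "\<Union> {E \<in> tail_cylinders. E \<subseteq> U} \<in> sigma_sets X (insert {} tail_cylinders)"
    using countable_subset[OF _ countable_tail_cylinders]
    by (intro sigma_sets_UNION) (auto intro: sigma_sets.Basic)
  ultimately show ?thesis by simp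
qed

text \<open>The condition involves only the edge at index \<open>i\<close>, which is constant on
  cylinders of paths with \<open>Suc i\<close> edges.\<close>

lemma openin_tail:
  "openin (subtopology (path_topology B) X) {x \<in> X. x i \<in> edges S i}"
proof -
  let ?U = "\<Union> {cylinder B (src B (x 0)) (map x [0..<Suc i]) | x. x \<in> path_space B \<and> x i \<in> edges S i}"
  have "openin (path_topology B) ?U"
    using openin_path_topology_cylinder[OF finite_path_path[OF diagram]]
    by (intro openin_Union) (auto simp del: upt_Suc)
  moreover have "{x \<in> X. x i \<in> edges S i} = ?U \<inter> X"
  proof
    show "{x \<in> X. x i \<in> edges S i} \<subseteq> ?U \<inter> X"
      using mem_cylinder_path[where n = "Suc i"] by (fastforce simp: extension_space_iff)
    show "?U \<inter> X \<subseteq> {x \<in> X. x i \<in> edges S i}"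
    proof
      fix y assume y: "y \<in> ?U \<inter> X"
      then obtain x where "x i \<in> edges S i" "y \<in> cylinder B (src B (x 0)) (map x [0..<Suc i])"
        by blast
      moreover from this(2) have "y i = map x [0..<Suc i] ! i"
        unfolding cylinder_def by simp
      ultimately have "y i \<in> edges S i" by (simp del: upt_Suc)
      with y show "y \<in> {x \<in> X. x i \<in> edges S i}" by blast
    qed
  qed
  ultimately show ?thesis by (auto simp: openin_subtopology)
qed

text \<open>Around each point of an open set a long enough tail cylinder fits. Conversely, a tail
  cylinder is a cylinder cut by countably many relatively open conditions, one for each later
  edge.\<close>

lemma borel_extension_eq:
  "sigma_sets X {U. openin (subtopology (path_topology B) X) U}
    = sigma_sets X (insert {} tail_cylinders)"
proof (rule sigma_sets_eqI)
  fix U assume "U \<in> {U. openin (subtopology (path_topology B) X) U}"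
  then obtain V where V: "openin (path_topology B) V" "U = V \<inter> X"
    by (auto simp: openin_subtopology)
  show "U \<in> sigma_sets X (insert {} tail_cylinders)"
  proof (rule sigma_sets_Union_tail_cylinders)
    fix x assume x: "x \<in> U"
    with V obtain m where m: "cylinder B (src B (x 0)) (map x [0..<m]) \<subseteq> V"
      using openin_path_topology_nbhd[OF V(1), of x] by blast
    from x V obtain n where n: "x \<in> path_space B" "\<And>i. i \<ge> n \<Longrightarrow> x i \<in> edges S i"
      by (auto simp: extension_space_iff)
    \<comment> \<open>A prefix of length at least \<open>m\<close> keeps the set inside
      \<open>V\<close>, and one of length at least \<open>n\<close> makes \<open>x\<close> satisfy
      the tail condition.\<close>
    let ?E = "tail_cylinder (src B (x 0)) (map x [0..<max m n])"
    have "?E \<subseteq> V"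
      using m tail_cylinder_subset cylinder_path_antimono[of m "max m n"] by (meson max.cobounded1 subset_trans)
    then have "?E \<subseteq> U" using V(2) tail_cylinder_subset_space by blast
    moreover have "x \<in> ?E" "?E \<in> tail_cylinders"
      using n by (auto intro!: mem_tail_cylinder_path mem_tail_cylinders_path)
    ultimately show "\<exists>E \<in> tail_cylinders. x \<in> E \<and> E \<subseteq> U" by blast
  qed
next
  let ?O = "{U. openin (subtopology (path_topology B) X) U}"
  interpret sigma_algebra X "sigma_sets X ?O"
    using openin_subset topspace_extension by (intro sigma_algebra_sigma_sets) fastforce
  fix E assume "E \<in> insert {} tail_cylinders"
  then consider "E = {}" | u p v where "finite_path B u p v" "E = tail_cylinder u p"
    by (auto simp: tail_cylinders_def)
  then show "E \<in> sigma_sets X ?O"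
  proof cases
    case 2
    have "E = (cylinder B u p \<inter> X) \<inter> (\<Inter>i. {x \<in> X. x (length p + i) \<in> edges S (length p + i)})"
      using tail_cylinder_subset_space[of u p] 2(2)
      by (auto simp: tail_cylinder_def) (metis le_add_diff_inverse)
    moreover have "(\<Inter>i. {x \<in> X. x (length p + i) \<in> edges S (length p + i)}) \<in> sigma_sets X ?O"
      using openin_tail by (intro countable_INT) auto
    moreover have "cylinder B u p \<inter> X \<in> sigma_sets X ?O"
      by (intro sigma_sets.Basic CollectI openin_subtopology_Int openin_path_topology_cylinder[OF 2(1)])
    ultimately show ?thesis by (simp add: Int)
  qed auto
qed

text \<open>A path that starts with the edges of \<open>p\<close>, all in \<open>S\<close>, and then
  stays in \<open>S\<close> is a path of \<open>S\<close>. The cylinders of the subdiagram are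
  therefore among the generators of the Borel sets of \<open>X\<close>.\<close>

lemma cylinder_sub_eq:
  assumes "finite_path S u p v"
  shows "cylinder S u p = tail_cylinder u p"
proof -
  have "walk S 0 u p v" using assms by (simp add: finite_path_def)
  then have "p ! i \<in> edges S i" if "i < length p" for i
    using walk_nth(1)[of S 0 u p v i] that by simp
  then show ?thesis
    by (auto simp: tail_cylinder_def cylinder_def path_space_sub) (metis not_le)
qed

lemma walk_sub: "walk S n v p w \<Longrightarrow> walk B n v p w"
  by (induction p arbitrary: n v) (auto simp: edges_sub)

lemma finite_path_sub: "finite_path S u p v \<Longrightarrow> finite_path B u p v"
  using W_subset by (auto simp: finite_path_def walk_sub)

lemma finite_path_sub_vertex: "finite_path S u p v \<Longrightarrow> v \<in> W (length p)"
  using finite_path_vertex[OF sub] by simp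

lemma openin_path_topology_sub:
  assumes "openin (path_topology S) U"
  shows "U \<in> sigma_sets X (insert {} tail_cylinders)"
proof (rule sigma_sets_Union_tail_cylinders)
  fix x assume x: "x \<in> U"
  then have "x \<in> path_space S"
    using openin_subset[OF assms] topspace_path_topology[OF sub] by blast
  note p = this finite_path_path[OF sub this]
  from openin_path_topology_nbhd[OF assms x] obtain n
    where n: "cylinder S (src B (x 0)) (map x [0..<n]) \<subseteq> U" by auto
  have "tail_cylinder (src B (x 0)) (map x [0..<n]) \<in> tail_cylinders"
    using p(1) by (intro mem_tail_cylinders_path) (auto simp: path_space_sub)
  with n mem_cylinder_path[OF p(1), of n] cylinder_sub_eq p(2)[of n]
  show "\<exists>E \<in> tail_cylinders. x \<in> E \<and> E \<subseteq> U" by auto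
qed

text \<open>Borel sets of the subdiagram have to be measurable in \<open>X\<close> before the
  extension can be compared with the given measure on them.\<close>

lemma borel_sub_subset:
  "sigma_sets (path_space S) {U. openin (path_topology S) U} \<subseteq> sigma_sets X (insert {} tail_cylinders)"
proof
  interpret sigma_algebra X "sigma_sets X (insert {} tail_cylinders)"
    by (intro sigma_algebra_sigma_sets tail_cylinders_subset)
  \<comment> \<open>Complements are taken in \<open>path_space S\<close> rather than in
    \<open>X\<close>, so the induction needs this set to be measurable in \<open>X\<close>.\<close>
  have top: "path_space S \<in> sigma_sets X (insert {} tail_cylinders)"
    using openin_path_topology_sub[OF openin_topspace] by (simp add: topspace_path_topology[OF sub])
  fix A assume "A \<in> sigma_sets (path_space S) {U. openin (path_topology S) U}"
  then show "A \<in> sigma_sets X (insert {} tail_cylinders)"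
    by (induction) (use top openin_path_topology_sub in \<open>auto intro: sigma_sets.Union\<close>)
qed

end

section \<open>Construction of the extended measure and its values\<close>

locale bratteli_pair_measure = bratteli_pair B W
  for B :: "('v, 'e) diagram" and W :: "nat \<Rightarrow> 'v set" +
  fixes \<nu> :: "(nat \<Rightarrow> 'e) measure"
  assumes prob: "prob_space \<nu>"
    and invariant: "tail_invariant_measure (vertex_subdiagram B W) \<nu>"
begin

lemma space_nu: "space \<nu> = path_space S"
  and sets_nu: "sets \<nu> = sigma_sets (path_space S) {U. openin (path_topology S) U}"
  using invariant topspace_path_topology[OF sub]
  by (simp_all add: tail_invariant_measure_def borel_measure_on_def)

lemma sets_nu_subset: "sets \<nu> \<subseteq> sigma_sets X (insert {} tail_cylinders)"
  using borel_sub_subset by (simp add: sets_nu)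

lemma cylinder_sets_nu: "finite_path S u p v \<Longrightarrow> cylinder S u p \<in> sets \<nu>"
  unfolding sets_nu by (intro sigma_sets.Basic CollectI openin_path_topology_cylinder)

text \<open>One path of \<open>S\<close> is picked for each vertex of \<open>W\<close>; the measure
  of its cylinder does not depend on the choice, by tail invariance of \<open>\<nu>\<close>.\<close>

definition rep :: "'v \<Rightarrow> 'v \<times> 'e list" where
  "rep v = (SOME (u, p). finite_path S u p v)"

abbreviation "rep_src v \<equiv> fst (rep v)"
abbreviation "rep_path v \<equiv> snd (rep v)"

definition weight :: "'v \<Rightarrow> ennreal" where
  "weight v = emeasure \<nu> (cylinder S (rep_src v) (rep_path v))"

lemma finite_path_rep:
  assumes "v \<in> W n"
  shows "finite_path S (rep_src v) (rep_path v) v" "length (rep_path v) = n"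
proof -
  obtain u p where p: "finite_path S u p v" "length p = n"
    using finite_path_exists[OF sub, of v n] assms by auto
  then have "case rep v of (u, p) \<Rightarrow> finite_path S u p v"
    unfolding rep_def by (intro someI[of "\<lambda>(u, p). finite_path S u p v" "(u, p)"]) simp
  then show rep: "finite_path S (rep_src v) (rep_path v) v" by (simp add: case_prod_beta)
  show "length (rep_path v) = n"
    using finite_path_length_unique[OF sub rep p(1)] p(2) by simp
qed

lemma emeasure_nu_cylinder:
  assumes "finite_path S u p v"
  shows "emeasure \<nu> (cylinder S u p) = weight v"
proof -
  have "finite_path S (rep_src v) (rep_path v) v"
    using finite_path_rep(1) finite_path_sub_vertex[OF assms] by blast
  moreover have "cylinder S u' p' \<inter> space \<nu> = cylinder S u' p'" for u' p'
    using cylinder_subset_path_space[of S] by (auto simp: space_nu)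
  ultimately show ?thesis
    using invariant assms unfolding weight_def tail_invariant_measure_def tail_invariant_def
    by metis
qed

text \<open>A last edge outside \<open>S\<close> means that no proper prefix can be followed by
  edges of \<open>S\<close> only. Every path in \<open>X\<close> therefore has exactly one minimal
  path as its entry into \<open>S\<close>; for paths of \<open>S\<close> it is the empty
  one.\<close>

definition minimal_paths :: "('v \<times> 'e list \<times> 'v) set" where
  "minimal_paths = {(u, p, v). finite_path B u p v \<and> v \<in> W (length p) \<and>
     (p \<noteq> [] \<longrightarrow> last p \<notin> edges S (length p - 1))}"

text \<open>The second component starts with the chosen path of \<open>S\<close> to
  \<open>v\<close>; that segment is as long as \<open>p\<close> and is what \<open>unmark\<close>
  replaces by \<open>p\<close>.\<close>

definition marked_paths :: "(('v \<times> 'e list \<times> 'v) \<times> (nat \<Rightarrow> 'e)) set" where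
  "marked_paths = (SIGMA (u, p, v) : minimal_paths. cylinder S (rep_src v) (rep_path v))"

definition unmark :: "('v \<times> 'e list \<times> 'v) \<times> (nat \<Rightarrow> 'e) \<Rightarrow> nat \<Rightarrow> 'e" where
  "unmark = (\<lambda>((u, p, v), y). graft p y)"

definition marked_measure :: "(('v \<times> 'e list \<times> 'v) \<times> (nat \<Rightarrow> 'e)) measure" where
  "marked_measure = restrict_space (count_space minimal_paths \<Otimes>\<^sub>M \<nu>) marked_paths"

definition extension :: "(nat \<Rightarrow> 'e) measure" where
  "extension = distr marked_measure (sigma X (insert {} tail_cylinders)) unmark"

lemma countable_minimal_paths: "countable minimal_paths"
proof (rule countable_subset)
  show "minimal_paths \<subseteq> {(u, p, v). finite_path B u p v \<and> v \<in> vertices B (length p)}"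
    using W_subset by (auto simp: minimal_paths_def)
  show "countable {(u, p, v). finite_path B u p v \<and> v \<in> vertices B (length p)}"
    using generalized by (intro countable_finite_paths) (auto simp: generalized_bratteli_diagram_def)
qed

text \<open>Edges of \<open>S\<close> are stripped from the end until an edge outside
  \<open>S\<close>, or the start, is reached.\<close>

lemma minimal_prefix:
  assumes "finite_path B u p v" "v \<in> W (length p)"
  shows "\<exists>q r z. p = q @ r \<and> (u, q, z) \<in> minimal_paths \<and> walk S (length q) z r v"
  using assms
proof (induction p arbitrary: v rule: rev_induct)
  case Nil
  then show ?case
    by (intro exI[of _ "[]"] exI[of _ v]) (simp add: minimal_paths_def)
next
  case (snoc e p)
  show ?case
  proof (cases "e \<in> edges S (length p)")
    case False
    then show ?thesis using snoc.prems
      by (intro exI[of _ "p @ [e]"] exI[of _ "[]"] exI[of _ v]) (simp add: minimal_paths_def)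
  next
    case True
    have e: "finite_path B u p (src B e)" "rng B e = v"
      using snoc.prems(1) by (auto simp: finite_path_append)
    have "src B e \<in> W (length p)" using True by (simp add: edges_sub)
    from snoc.IH[OF e(1) this] obtain q r z where
      "p = q @ r" "(u, q, z) \<in> minimal_paths" "walk S (length q) z r (src B e)" by blast
    with True e(2) show ?thesis
      by (intro exI[of _ q] exI[of _ "r @ [e]"] exI[of _ z]) (simp add: walk_append)
  qed
qed

text \<open>Cutting a path where it enters \<open>S\<close> for good recovers its mark, so a single
  minimal path contributes and the preimage is one rectangle. Both the measurability of
  \<open>unmark\<close> and the values of the extension come from this.\<close>

lemma unmark_vimage:
  assumes q: "(u, q, z) \<in> minimal_paths" and r: "walk S (length q) z r v"
  shows "{m \<in> marked_paths. unmark m \<in> tail_cylinder u (q @ r)}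
    = {(u, q, z)} \<times> cylinder S (rep_src z) (rep_path z @ r)"
proof -
  have z: "finite_path B u q z" "z \<in> W (length q)" using q by (auto simp: minimal_paths_def)
  note rep = finite_path_rep[OF z(2)]
  have path: "finite_path S (rep_src z) (rep_path z @ r) v"
    using rep r by (auto simp: finite_path_append)
  have r_edges: "r ! i \<in> edges S (length q + i)" if "i < length r" for i
    using walk_nth(1)[OF r that] .
  have fwd: "(u, q, z) = (u', q', z') \<and> y \<in> cylinder S (rep_src z) (rep_path z @ r)"
    if m: "((u', q', z'), y) \<in> marked_paths" and t: "graft q' y \<in> tail_cylinder u (q @ r)"
    for u' q' z' y
  proof -
    let ?x = "graft q' y"
    have q': "(u', q', z') \<in> minimal_paths" and y: "y \<in> cylinder S (rep_src z') (rep_path z')"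
      using m by (auto simp: marked_paths_def)
    have z': "finite_path B u' q' z'" "z' \<in> W (length q')"
      using q' by (auto simp: minimal_paths_def)
    note rep' = finite_path_rep[OF z'(2)]
    have y_path: "y \<in> path_space S" using y by (simp add: cylinder_def)
    have y_end: "src B (y (length q')) = z'" using cylinderD(3)[OF rep'(1) y] rep'(2) by simp
    have x': "?x \<in> cylinder B u' q'"
      using z'(1) y_end y_path path_spaceD(2)[of y S]
      by (intro graft_mem_cylinder) (auto simp: path_space_sub edges_sub)
    have x_nth: "?x i = (q @ r) ! i" if "i < length (q @ r)" for i
      using t that unfolding tail_cylinder_def cylinder_def by blast
    have x_q: "?x \<in> cylinder B u q"
      using t by (auto simp: tail_cylinder_def cylinder_def nth_append)
    have tail_q: "?x i \<in> edges S i" if "i \<ge> length q" for i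
    proof (cases "i < length (q @ r)")
      case True
      then show ?thesis using x_nth[OF True] r_edges[of "i - length q"] that
        by (simp add: nth_append)
    next
      case False
      then show ?thesis using t unfolding tail_cylinder_def by auto
    qed
    have tail_q': "?x i \<in> edges S i" if "i \<ge> length q'" for i
      using y_path that by (simp add: graft_def path_space_sub)
    \<comment> \<open>A minimal path cannot reach beyond an index from which all edges lie in
      \<open>S\<close>, since its last edge does not. Applied in both directions, this forces
      \<open>q\<close> and \<open>q'\<close> to have the same length.\<close>
    have exit: "length p \<le> n"
      if "(w, p, w') \<in> minimal_paths" "?x \<in> cylinder B w p" "\<And>i. i \<ge> n \<Longrightarrow> ?x i \<in> edges S i"
      for w p w' n
    proof (rule ccontr)
      assume "\<not> length p \<le> n"
      then have ne: "p \<noteq> []" and "n \<le> length p - 1" by auto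
      then have "?x (length p - 1) \<in> edges S (length p - 1)" using that(3) by blast
      moreover have "?x (length p - 1) = last p"
        using that(2) ne by (simp add: cylinder_def last_conv_nth)
      ultimately show False using that(1) ne by (simp add: minimal_paths_def)
    qed
    have len: "length q = length q'"
      using exit[of u q z "length q'"] exit[of u' q' z' "length q"] q q' x' x_q tail_q tail_q'
      by (intro antisym) auto
    have eq: "u = u'" "q = q'" "z = z'"
      using cylinderD[OF z(1) x_q] cylinderD[OF z'(1) x'] len by metis+
    \<comment> \<open>Below \<open>length q\<close> this is membership in the cylinder of the chosen
      path; from there on \<open>graft\<close> leaves \<open>y\<close> unchanged and the edges of
      \<open>r\<close> are read off the tail cylinder.\<close>
    have "y i = (rep_path z @ r) ! i" if "i < length (rep_path z @ r)" for i
    proof (cases "i < length q")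
      case True
      then show ?thesis using y eq rep(2) by (simp add: cylinder_def nth_append)
    next
      case False
      then show ?thesis using x_nth[of i] eq that rep(2) by (simp add: graft_def nth_append)
    qed
    then show ?thesis using eq y by (simp add: cylinder_def)
  qed
  have bwd: "((u, q, z), y) \<in> marked_paths \<and> graft q y \<in> tail_cylinder u (q @ r)"
    if y: "y \<in> cylinder S (rep_src z) (rep_path z @ r)" for y
  proof
    have y_path: "y \<in> path_space S" using y by (simp add: cylinder_def)
    have y': "y \<in> cylinder S (rep_src z) (rep_path z)"
      using y by (auto simp: cylinder_def nth_append)
    then show "((u, q, z), y) \<in> marked_paths" using q by (simp add: marked_paths_def)
    have y_end: "src B (y (length q)) = z" using cylinderD(3)[OF rep(1) y'] rep(2) by simp
    have x: "graft q y \<in> cylinder B u q"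
      using z(1) y_end y_path path_spaceD(2)[of y S]
      by (intro graft_mem_cylinder) (auto simp: path_space_sub edges_sub)
    have "y i = r ! (i - length q)" if "length q \<le> i" "i < length q + length r" for i
      using y that rep(2) unfolding cylinder_def by (auto simp: nth_append)
    then have "graft q y i = (q @ r) ! i" if "i < length (q @ r)" for i
      using that by (auto simp: graft_def nth_append)
    moreover have "graft q y i \<in> edges S i" if "i \<ge> length (q @ r)" for i
      using y_path that by (simp add: graft_def path_space_sub)
    ultimately show "graft q y \<in> tail_cylinder u (q @ r)"
      using x by (simp add: tail_cylinder_def cylinder_def)
  qed
  show ?thesis
  proof (intro set_eqI iffI)
    fix m assume "m \<in> {m \<in> marked_paths. unmark m \<in> tail_cylinder u (q @ r)}"
    moreover obtain u' q' z' y where "m = ((u', q', z'), y)" by (metis prod.collapse)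
    ultimately show "m \<in> {(u, q, z)} \<times> cylinder S (rep_src z) (rep_path z @ r)"
      using fwd[of u' q' z' y] by (auto simp: unmark_def)
  next
    fix m assume "m \<in> {(u, q, z)} \<times> cylinder S (rep_src z) (rep_path z @ r)"
    then show "m \<in> {m \<in> marked_paths. unmark m \<in> tail_cylinder u (q @ r)}"
      using bwd by (auto simp: unmark_def)
  qed
qed

lemma singleton_Times_sets:
  assumes "m \<in> minimal_paths" "A \<in> sets \<nu>"
  shows "{m} \<times> A \<in> sets (count_space minimal_paths \<Otimes>\<^sub>M \<nu>)"
  using assms by (intro pair_measureI) auto

lemma marked_paths_sets: "marked_paths \<in> sets (count_space minimal_paths \<Otimes>\<^sub>M \<nu>)"
proof -
  have "marked_paths = (\<Union>m \<in> minimal_paths. {m} \<times>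
      cylinder S (rep_src (snd (snd m))) (rep_path (snd (snd m))))"
    by (auto simp: marked_paths_def)
  moreover have "{m} \<times> cylinder S (rep_src (snd (snd m))) (rep_path (snd (snd m)))
      \<in> sets (count_space minimal_paths \<Otimes>\<^sub>M \<nu>)" if "m \<in> minimal_paths" for m
  proof (intro singleton_Times_sets that cylinder_sets_nu)
    have "snd (snd m) \<in> W (length (fst (snd m)))" using that by (auto simp: minimal_paths_def)
    then show "finite_path S (rep_src (snd (snd m))) (rep_path (snd (snd m))) (snd (snd m))"
      by (rule finite_path_rep(1))
  qed
  ultimately show ?thesis
    using countable_minimal_paths by (auto intro!: sets.countable_UN')
qed

lemma space_marked_measure: "space marked_measure = marked_paths"
  using sets.sets_into_space[OF marked_paths_sets]
  by (auto simp: marked_measure_def space_restrict_space)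

lemma sets_marked_measure:
  "A \<in> sets marked_measure \<longleftrightarrow>
    A \<subseteq> marked_paths \<and> A \<in> sets (count_space minimal_paths \<Otimes>\<^sub>M \<nu>)"
  unfolding marked_measure_def
  using sets.sets_into_space[OF marked_paths_sets] marked_paths_sets
  by (subst sets_restrict_space_iff) (auto simp: Int_absorb2)

lemma emeasure_marked_measure:
  assumes "m \<in> minimal_paths" "A \<in> sets \<nu>" "{m} \<times> A \<subseteq> marked_paths"
  shows "emeasure marked_measure ({m} \<times> A) = emeasure \<nu> A"
proof -
  interpret prob_space \<nu> by (rule prob)
  have "emeasure marked_measure ({m} \<times> A)
      = emeasure (count_space minimal_paths \<Otimes>\<^sub>M \<nu>) ({m} \<times> A)"
    unfolding marked_measure_def
    using assms(3) sets.sets_into_space[OF marked_paths_sets] marked_paths_sets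
    by (intro emeasure_restrict_space) (auto simp: Int_absorb2)
  also have "\<dots> = emeasure \<nu> A"
    using assms by (subst emeasure_pair_measure_Times) auto
  finally show ?thesis .
qed

lemma tail_cylinder_cases:
  assumes "E \<in> tail_cylinders"
  obtains u q r z v where "E = tail_cylinder u (q @ r)" "(u, q, z) \<in> minimal_paths"
    "walk S (length q) z r v"
proof -
  obtain u p v where "E = tail_cylinder u p" "finite_path B u p v" "v \<in> W (length p)"
    using assms by (auto simp: tail_cylinders_def)
  with minimal_prefix[of u p v] that show ?thesis by blast
qed

lemma finite_path_rep_append:
  assumes "(u, q, z) \<in> minimal_paths" "walk S (length q) z r v"
  shows "finite_path S (rep_src z) (rep_path z @ r) v"
  using finite_path_rep[of z "length q"] assms by (auto simp: finite_path_append minimal_paths_def)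

lemma measurable_unmark [measurable]:
  "unmark \<in> marked_measure \<rightarrow>\<^sub>M sigma X (insert {} tail_cylinders)"
proof (rule measurable_measure_of)
  show "insert {} tail_cylinders \<subseteq> Pow X" by (rule tail_cylinders_subset)
  show "unmark \<in> space marked_measure \<rightarrow> X"
  proof
    fix m assume m: "m \<in> space marked_measure"
    obtain u q z y where m_eq: "m = ((u, q, z), y)" by (metis prod.collapse)
    \<comment> \<open>The continuation \<open>[]\<close> brings the cylinder into the form of
      \<open>unmark_vimage\<close>, which then places the image in the tail cylinder of the minimal
      path itself.\<close>
    with m have q: "(u, q, z) \<in> minimal_paths" and y: "y \<in> cylinder S (rep_src z) (rep_path z @ [])"
      by (auto simp: space_marked_measure marked_paths_def)
    have "m \<in> {(u, q, z)} \<times> cylinder S (rep_src z) (rep_path z @ [])"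
      using m_eq y by simp
    then have "unmark m \<in> tail_cylinder u (q @ [])"
      using unmark_vimage[OF q, of "[]" z] by auto
    then show "unmark m \<in> X" using tail_cylinder_subset_space by blast
  qed
  fix E assume "E \<in> insert {} tail_cylinders"
  then consider "E = {}" | "E \<in> tail_cylinders" by blast
  then show "unmark -` E \<inter> space marked_measure \<in> sets marked_measure"
  proof cases
    case 2
    then obtain u q r z v where E: "E = tail_cylinder u (q @ r)" "(u, q, z) \<in> minimal_paths"
      "walk S (length q) z r v" by (rule tail_cylinder_cases)
    have "unmark -` E \<inter> space marked_measure = {(u, q, z)} \<times> cylinder S (rep_src z) (rep_path z @ r)"
      unfolding unmark_vimage[OF E(2,3), symmetric] E(1) space_marked_measure by blast
    moreover have "\<dots> \<in> sets marked_measure"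
      unfolding sets_marked_measure
    proof
      show "{(u, q, z)} \<times> cylinder S (rep_src z) (rep_path z @ r) \<subseteq> marked_paths"
        using unmark_vimage[OF E(2,3)] by blast
    qed (intro singleton_Times_sets E(2) cylinder_sets_nu[OF finite_path_rep_append[OF E(2,3)]])
    ultimately show ?thesis by simp
  qed simp
qed

lemma space_extension: "space extension = X"
  and sets_extension: "sets extension = sigma_sets X (insert {} tail_cylinders)"
  using tail_cylinders_subset by (simp_all add: extension_def)

lemma emeasure_extension:
  assumes "A \<in> sigma_sets X (insert {} tail_cylinders)"
  shows "emeasure extension A = emeasure marked_measure {m \<in> marked_paths. unmark m \<in> A}"
  unfolding extension_def
  using assms tail_cylinders_subset
  by (subst emeasure_distr[OF measurable_unmark])
    (auto simp: space_marked_measure intro!: arg_cong[where f = "emeasure marked_measure"])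

text \<open>The vertex \<open>z\<close> at which the minimal prefix ends drops out: the chosen path
  to \<open>z\<close> continued by \<open>r\<close> is a path of \<open>S\<close> to
  \<open>v\<close>, and tail invariance of \<open>\<nu>\<close> gives its cylinder the weight of
  \<open>v\<close>.\<close>

lemma emeasure_extension_tail_cylinder:
  assumes "finite_path B u p v" "v \<in> W (length p)"
  shows "emeasure extension (tail_cylinder u p) = weight v"
proof -
  from minimal_prefix[OF assms] obtain q r z
    where q: "p = q @ r" "(u, q, z) \<in> minimal_paths" "walk S (length q) z r v" by blast
  have "tail_cylinder u p \<in> sigma_sets X (insert {} tail_cylinders)"
    using assms by (intro sigma_sets.Basic) (auto simp: tail_cylinders_def)
  then have "emeasure extension (tail_cylinder u p)
      = emeasure marked_measure ({(u, q, z)} \<times> cylinder S (rep_src z) (rep_path z @ r))"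
    unfolding q(1) by (simp add: emeasure_extension unmark_vimage[OF q(2,3)])
  also have "\<dots> = emeasure \<nu> (cylinder S (rep_src z) (rep_path z @ r))"
  proof (rule emeasure_marked_measure)
    show "{(u, q, z)} \<times> cylinder S (rep_src z) (rep_path z @ r) \<subseteq> marked_paths"
      using unmark_vimage[OF q(2,3)] by blast
  qed (intro q(2) cylinder_sets_nu[OF finite_path_rep_append[OF q(2,3)]])+
  also have "\<dots> = weight v"
    by (rule emeasure_nu_cylinder[OF finite_path_rep_append[OF q(2,3)]])
  finally show ?thesis .
qed

lemma rep_level_zero:
  assumes "v \<in> W 0"
  shows "rep v = (v, [])"
proof -
  have "rep_path v = []" using finite_path_rep(2)[OF assms] by simp
  with finite_path_rep(1)[OF assms] have "rep_src v = v" by (simp add: finite_path_def)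
  with \<open>rep_path v = []\<close> show ?thesis by (simp add: prod_eq_iff)
qed

lemma countable_W: "countable (W n)"
  using W_subset generalized
  by (auto simp: generalized_bratteli_diagram_def intro: countable_subset)

text \<open>Paths of \<open>S\<close> carry the empty mark at their start, so the preimage of
  \<open>A\<close> consists of the pieces of \<open>A\<close> over the starting vertices in
  \<open>W 0\<close>, and \<open>unmark\<close> leaves each piece unchanged.\<close>

lemma emeasure_extension_nu:
  assumes A: "A \<in> sets \<nu>"
  shows "emeasure extension A = emeasure \<nu> A"
proof -
  have A_path: "A \<subseteq> path_space S" using sets.sets_into_space[OF A] by (simp add: space_nu)
  have empty_path: "finite_path S u [] u" if "u \<in> W 0" for u
    using that by (simp add: finite_path_def)
  have minimal: "(u, [], u) \<in> minimal_paths" if "u \<in> W 0" for u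
    using that finite_path_sub[OF empty_path[OF that]] by (simp add: minimal_paths_def)
  have piece: "A \<inter> cylinder S u [] \<in> sets \<nu>" if "u \<in> W 0" for u
    using A cylinder_sets_nu[OF empty_path[OF that]] by blast
  have marked: "{(u, [], u)} \<times> (A \<inter> cylinder S u []) \<subseteq> marked_paths" if "u \<in> W 0" for u
    using minimal[OF that] rep_level_zero[OF that] by (auto simp: marked_paths_def)
  have "{m \<in> marked_paths. unmark m \<in> A} = (\<Union>u \<in> W 0. {(u, [], u)} \<times> (A \<inter> cylinder S u []))"
    (is "?L = ?R")
  proof
    show "?R \<subseteq> ?L"
    proof
      fix m assume "m \<in> ?R"
      then obtain u y where m: "m = ((u, [], u), y)" "u \<in> W 0" "y \<in> A" "y \<in> cylinder S u []" by blast
      then have "m \<in> marked_paths" using marked[OF m(2)] by blast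
      with m show "m \<in> ?L" by (simp add: unmark_def graft_def)
    qed
    show "?L \<subseteq> ?R"
    proof
      fix m assume m: "m \<in> ?L"
      obtain u p v y where m_eq: "m = ((u, p, v), y)" by (metis prod.collapse)
      have p: "(u, p, v) \<in> minimal_paths" and y: "y \<in> cylinder S (rep_src v) (rep_path v)"
        and gA: "graft p y \<in> A"
        using m m_eq by (auto simp: marked_paths_def unmark_def)
      \<comment> \<open>A nonempty minimal path ends with an edge outside \<open>S\<close>, whereas
        the grafted path lies in \<open>path_space S\<close>.\<close>
      have "p = []"
      proof (rule ccontr)
        assume ne: "p \<noteq> []"
        then have "graft p y (length p - 1) = last p" by (simp add: graft_def last_conv_nth)
        moreover have "graft p y (length p - 1) \<in> edges S (length p - 1)"
          using gA A_path by (auto simp: path_space_sub)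
        ultimately show False using p ne by (simp add: minimal_paths_def)
      qed
      with p have v: "v = u" "u \<in> W 0" by (auto simp: minimal_paths_def finite_path_def)
      with m_eq y gA \<open>p = []\<close> show "m \<in> ?R"
        using rep_level_zero[OF v(2)] by (auto simp: graft_def)
    qed
  qed
  then have "emeasure extension A
      = emeasure marked_measure (\<Union>u \<in> W 0. {(u, [], u)} \<times> (A \<inter> cylinder S u []))"
    using A sets_nu_subset by (simp add: emeasure_extension subset_iff)
  \<comment> \<open>Here \<open>W 0\<close> is known only to be countable, so the sum over starting
    vertices is an integral for the counting measure.\<close>
  also have "\<dots> = (\<integral>\<^sup>+u. emeasure marked_measure ({(u, [], u)} \<times> (A \<inter> cylinder S u [])) \<partial>count_space (W 0))"
  proof (rule emeasure_UN_countable)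
    show "disjoint_family_on (\<lambda>u. {(u, [], u)} \<times> (A \<inter> cylinder S u [])) (W 0)"
      by (auto simp: disjoint_family_on_def)
    show "{(u, [], u)} \<times> (A \<inter> cylinder S u []) \<in> sets marked_measure" if "u \<in> W 0" for u
      unfolding sets_marked_measure
      using marked[OF that] singleton_Times_sets[OF minimal[OF that] piece[OF that]] by blast
  qed (rule countable_W)
  also have "\<dots> = (\<integral>\<^sup>+u. emeasure \<nu> (A \<inter> cylinder S u []) \<partial>count_space (W 0))"
    using minimal piece marked by (intro nn_integral_cong emeasure_marked_measure) auto
  also have "\<dots> = emeasure \<nu> (\<Union>u \<in> W 0. A \<inter> cylinder S u [])"
    using piece
    by (intro emeasure_UN_countable[symmetric] countable_W)
      (auto simp: disjoint_family_on_def cylinder_def)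
  also have "(\<Union>u \<in> W 0. A \<inter> cylinder S u []) = A"
    using A_path by (auto simp: cylinder_def path_space_sub edges_sub)
  finally show ?thesis .
qed

section \<open>Exhaustion by late tails and tail invariance of the extension\<close>

definition tail_from :: "nat \<Rightarrow> (nat \<Rightarrow> 'e) set" where
  "tail_from n = {x \<in> path_space B. \<forall>i \<ge> n. x i \<in> edges S i}"

lemma tail_cylinder_sets:
  "finite_path B u p v \<Longrightarrow> v \<in> W (length p) \<Longrightarrow> tail_cylinder u p \<in> sets extension"
  unfolding sets_extension by (intro sigma_sets.Basic) (auto simp: tail_cylinders_def)

lemma tail_cylinder_disjoint:
  assumes "finite_path B u p v" "finite_path B u' p' v'" "length p = length p'"
    and "(u, p, v) \<noteq> (u', p', v')"
  shows "tail_cylinder u p \<inter> tail_cylinder u' p' = {}"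
proof (rule ccontr)
  assume "tail_cylinder u p \<inter> tail_cylinder u' p' \<noteq> {}"
  then obtain x where "x \<in> cylinder B u p" "x \<in> cylinder B u' p'"
    using tail_cylinder_subset by blast
  from cylinderD[OF assms(1) this(1)] cylinderD[OF assms(2) this(2)] assms(3,4) show False
    by metis
qed

text \<open>This depends on the level and the endpoint of a finite path, not on the path itself,
  which is the source of tail invariance.\<close>

definition continuations :: "nat \<Rightarrow> 'v \<Rightarrow> nat \<Rightarrow> ('e list \<times> 'v) set" where
  "continuations n v k = {(r, w). walk B n v r w \<and> length r = k \<and> w \<in> W (n + k)}"

lemma cylinder_Int_tail_from:
  assumes p: "finite_path B u p v"
  shows "cylinder B u p \<inter> tail_from (length p + k)
    = (\<Union>(r, w) \<in> continuations (length p) v k. tail_cylinder u (p @ r))"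
proof
  show "(\<Union>(r, w) \<in> continuations (length p) v k. tail_cylinder u (p @ r))
      \<subseteq> cylinder B u p \<inter> tail_from (length p + k)"
    by (auto simp: tail_cylinder_def tail_from_def continuations_def cylinder_def nth_append)
  show "cylinder B u p \<inter> tail_from (length p + k)
      \<subseteq> (\<Union>(r, w) \<in> continuations (length p) v k. tail_cylinder u (p @ r))"
  proof
    fix x assume x: "x \<in> cylinder B u p \<inter> tail_from (length p + k)"
    let ?n = "length p"
    let ?r = "map x [?n..<?n + k]"
    have path: "x \<in> path_space B" and tail: "\<And>i. i \<ge> ?n + k \<Longrightarrow> x i \<in> edges S i"
      using x by (auto simp: tail_from_def)
    note u = cylinderD[OF p, of x]
    have "p @ ?r = map x [0..<?n + k]"
      using u(2) x by (simp add: upt_add_eq_append[of 0 ?n k])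
    then have "x \<in> tail_cylinder u (p @ ?r)"
      using mem_tail_cylinder_path[OF path tail] u(1) x by simp
    moreover have "src B (x (?n + k)) \<in> W (?n + k)" using tail[of "?n + k"] by (simp add: edges_sub)
    then have "(?r, src B (x (?n + k))) \<in> continuations ?n v k"
      using walk_path[OF path, of ?n k] u(3) x by (simp add: continuations_def)
    ultimately show "x \<in> (\<Union>(r, w) \<in> continuations ?n v k. tail_cylinder u (p @ r))" by blast
  qed
qed

text \<open>Prefixing a path to \<open>v\<close> turns continuations into finite paths from level
  zero, of which there are countably many.\<close>

lemma countable_continuations:
  assumes "finite_path B u p v"
  shows "countable (continuations (length p) v k)"
proof (rule countable_subset)
  let ?F = "{(u, p, v). finite_path B u p v \<and> v \<in> vertices B (length p)}"
  show "continuations (length p) v k \<subseteq> (\<lambda>(u, q, w). (drop (length p) q, w)) ` ?F"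
  proof
    fix c assume "c \<in> continuations (length p) v k"
    then obtain r w where c: "c = (r, w)" "walk B (length p) v r w" "length r = k" "w \<in> W (length p + k)"
      by (auto simp: continuations_def)
    then have "(u, p @ r, w) \<in> ?F" using assms W_subset[of "length p + k"] by (auto simp: finite_path_append)
    then show "c \<in> (\<lambda>(u, q, w). (drop (length p) q, w)) ` ?F"
      using c(1) by (intro image_eqI[of _ _ "(u, p @ r, w)"]) auto
  qed
  show "countable ((\<lambda>(u, q, w). (drop (length p) q, w)) ` ?F)"
    using generalized
    by (intro countable_image countable_finite_paths) (auto simp: generalized_bratteli_diagram_def)
qed

lemma emeasure_cylinder_Int_tail_from:
  assumes p: "finite_path B u p v"
  shows "cylinder B u p \<inter> tail_from (length p + k) \<in> sets extension"
    and "emeasure extension (cylinder B u p \<inter> tail_from (length p + k))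
      = (\<integral>\<^sup>+(r, w). weight w \<partial>count_space (continuations (length p) v k))"
proof -
  let ?C = "continuations (length p) v k"
  have path: "finite_path B u (p @ r) w" "w \<in> W (length (p @ r))" if "(r, w) \<in> ?C" for r w
    using that p by (auto simp: continuations_def finite_path_append)
  have sets: "(\<lambda>(r, w). tail_cylinder u (p @ r)) c \<in> sets extension" if "c \<in> ?C" for c
    using tail_cylinder_sets path that by (auto split: prod.splits)
  show "cylinder B u p \<inter> tail_from (length p + k) \<in> sets extension"
    unfolding cylinder_Int_tail_from[OF p]
    using sets by (intro sets.countable_UN' countable_continuations[OF p]) auto
  have "emeasure extension (cylinder B u p \<inter> tail_from (length p + k))
      = (\<integral>\<^sup>+c. emeasure extension ((\<lambda>(r, w). tail_cylinder u (p @ r)) c) \<partial>count_space ?C)"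
    unfolding cylinder_Int_tail_from[OF p]
  proof (rule emeasure_UN_countable[OF sets countable_continuations[OF p]])
    show "disjoint_family_on (\<lambda>(r, w). tail_cylinder u (p @ r)) ?C"
      unfolding disjoint_family_on_def
    proof (intro ballI impI)
      fix c d assume cd: "c \<in> ?C" "d \<in> ?C" "c \<noteq> d"
      obtain r w r' w' where eq: "c = (r, w)" "d = (r', w')" by (metis prod.collapse)
      have "length (p @ r) = length (p @ r')" using cd eq by (simp add: continuations_def)
      from tail_cylinder_disjoint[OF path(1) path(1) this] cd eq
      show "(case c of (r, w) \<Rightarrow> tail_cylinder u (p @ r)) \<inter> (case d of (r, w) \<Rightarrow> tail_cylinder u (p @ r)) = {}"
        by auto
    qed
  qed
  also have "\<dots> = (\<integral>\<^sup>+(r, w). weight w \<partial>count_space ?C)"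
    using path by (intro nn_integral_cong) (auto intro!: emeasure_extension_tail_cylinder)
  finally show "emeasure extension (cylinder B u p \<inter> tail_from (length p + k))
      = (\<integral>\<^sup>+(r, w). weight w \<partial>count_space ?C)" .
qed

lemma incseq_tail_from: "incseq tail_from"
  by (intro incseq_SucI) (auto simp: tail_from_def)

lemma Union_tail_from: "(\<Union>k. tail_from (n + k)) = X"
proof
  show "(\<Union>k. tail_from (n + k)) \<subseteq> X"
  proof
    fix x assume "x \<in> (\<Union>k. tail_from (n + k))"
    then obtain k where "x \<in> tail_from (n + k)" by blast
    then show "x \<in> X"
      unfolding extension_space_iff by (intro conjI exI[of _ "n + k"]) (simp_all add: tail_from_def)
  qed
  show "X \<subseteq> (\<Union>k. tail_from (n + k))"
  proof
    fix x assume "x \<in> X"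
    then obtain m where "x \<in> path_space B" "\<forall>i\<ge>m. x i \<in> edges S i" by (auto simp: extension_space_iff)
    then have "x \<in> tail_from (n + m)" by (simp add: tail_from_def)
    then show "x \<in> (\<Union>k. tail_from (n + k))" by blast
  qed
qed

text \<open>Continuity from below along the increasing sets \<open>tail_from\<close>. The right-hand
  side contains the path only through its length and endpoint, and the endpoint determines the
  length; hence tail invariance.\<close>

lemma emeasure_extension_cylinder:
  assumes p: "finite_path B u p v"
  shows "emeasure extension (cylinder B u p \<inter> X)
    = (SUP k. \<integral>\<^sup>+(r, w). weight w \<partial>count_space (continuations (length p) v k))"
proof -
  have "(SUP k. emeasure extension (cylinder B u p \<inter> tail_from (length p + k)))
      = emeasure extension (\<Union>k. cylinder B u p \<inter> tail_from (length p + k))"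
  proof (rule SUP_emeasure_incseq)
    show "range (\<lambda>k. cylinder B u p \<inter> tail_from (length p + k)) \<subseteq> sets extension"
      using emeasure_cylinder_Int_tail_from(1)[OF p] by blast
    show "incseq (\<lambda>k. cylinder B u p \<inter> tail_from (length p + k))"
      by (intro incseq_SucI) (auto simp: tail_from_def)
  qed
  also have "(\<Union>k. cylinder B u p \<inter> tail_from (length p + k)) = cylinder B u p \<inter> X"
    using Union_tail_from[of "length p"] by blast
  finally show ?thesis by (simp add: emeasure_cylinder_Int_tail_from(2)[OF p])
qed

lemma tail_invariant_extension: "tail_invariant B extension"
  unfolding tail_invariant_def space_extension
  using finite_path_length_unique[OF diagram] by (metis emeasure_extension_cylinder)

section \<open>Identification with the unique measure extension\<close>

lemma borel_measure_on_extension: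
  "borel_measure_on (subtopology (path_topology B) X) M
    \<longleftrightarrow> space M = X \<and> sets M = sigma_sets X (insert {} tail_cylinders)"
  unfolding borel_measure_on_def topspace_extension borel_extension_eq ..

lemma is_measure_extension_extension: "is_measure_extension B S \<nu> extension"
  unfolding is_measure_extension_def
proof (intro conjI allI impI ballI)
  show "borel_measure_on (subtopology (path_topology B) X) extension"
    by (simp add: borel_measure_on_extension space_extension sets_extension)
  show "tail_invariant B extension" by (rule tail_invariant_extension)
  show "emeasure extension A = emeasure \<nu> A" if "A \<in> sets \<nu>" for A
    using that by (rule emeasure_extension_nu)
  fix u p u' p' v
  assume "finite_path B u p v \<and> finite_path S u' p' v"
  then have p: "finite_path B u p v" "finite_path S u' p' v" by auto
  \<comment> \<open>The path of \<open>S\<close> is also a path of \<open>B\<close> to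
    \<open>v\<close>, so the two lengths agree.\<close>
  have "v \<in> W (length p)"
    using finite_path_sub_vertex[OF p(2)] finite_path_length_unique[OF diagram p(1) finite_path_sub[OF p(2)]]
    by simp
  then show "emeasure extension {x \<in> cylinder B u p. \<forall>i\<ge>length p. x i \<in> edges S i}
      = emeasure \<nu> (cylinder S u' p')"
    using emeasure_extension_tail_cylinder[OF p(1)] emeasure_nu_cylinder[OF p(2)]
    by (simp add: tail_cylinder_def)
qed

text \<open>The prescribed values on tail cylinders are finite because \<open>\<nu>\<close> is a
  probability measure. Tail cylinders with the empty set form an intersection-stable generator that
  contains a countable cover of \<open>X\<close>, so these values determine the measure.\<close>

lemma measure_extension_unique:
  assumes "is_measure_extension B S \<nu> M" "is_measure_extension B S \<nu> N"
  shows "M = N"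
proof -
  have val: "emeasure L (tail_cylinder u p) = weight v"
    if L: "is_measure_extension B S \<nu> L" and p: "finite_path B u p v" "v \<in> W (length p)" for L u p v
    using L p(1) finite_path_rep(1)[OF p(2)]
    unfolding is_measure_extension_def tail_cylinder_def weight_def by blast
  have eq: "emeasure M E = emeasure N E" if "E \<in> insert {} tail_cylinders" for E
    using that val[OF assms(1)] val[OF assms(2)] by (auto simp: tail_cylinders_def)
  interpret prob_space \<nu> by (rule prob)
  have fin: "emeasure M E \<noteq> \<infinity>" if "E \<in> tail_cylinders" for E
    using that val[OF assms(1)] emeasure_finite by (auto simp: tail_cylinders_def weight_def)
  show ?thesis
    using assms
    by (intro measure_eqI_generator_eq_countable[OF Int_stable_tail_cylinders
        tail_cylinders_subset eq _ _ subset_insertI Union_tail_cylinders countable_tail_cylinders fin])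
      (auto simp: is_measure_extension_def borel_measure_on_extension)
qed

lemma measure_extension_eq: "measure_extension B S \<nu> = extension"
  unfolding measure_extension_def
  using is_measure_extension_extension measure_extension_unique by (intro the_equality) auto

end

section \<open>Counting finite paths to a vertex\<close>

definition paths_to :: "('v, 'e) diagram \<Rightarrow> nat \<Rightarrow> 'v \<Rightarrow> ('v \<times> 'e list) set" where
  "paths_to B n v = {(u, p). finite_path B u p v \<and> length p = n}"

lemma paths_to_0:
  assumes "v \<in> vertices B 0"
  shows "paths_to B 0 v = {(v, [])}"
  using assms by (auto simp: paths_to_def finite_path_def)

lemma paths_to_Suc:
  "paths_to B (Suc n) v =
    (\<Union>e \<in> {e \<in> edges B n. rng B e = v}. (\<lambda>(u, p). (u, p @ [e])) ` paths_to B n (src B e))"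
    (is "?L = ?R")
proof
  show "?R \<subseteq> ?L" by (auto simp: paths_to_def finite_path_append)
  show "?L \<subseteq> ?R"
  proof
    fix q assume "q \<in> ?L"
    then obtain u p e where q: "q = (u, p @ [e])" "finite_path B u (p @ [e]) v" "length p = n"
      by (auto simp: paths_to_def length_Suc_conv_rev)
    then have e: "e \<in> edges B n" "rng B e = v" "finite_path B u p (src B e)"
      by (auto simp: finite_path_append)
    then have "(u, p) \<in> paths_to B n (src B e)" using q(3) by (simp add: paths_to_def)
    then have "q \<in> (\<lambda>(u, p). (u, p @ [e])) ` paths_to B n (src B e)"
      using q(1) by (intro image_eqI[of _ _ "(u, p)"]) simp_all
    then show "q \<in> ?R" using e(1,2) by (intro UN_I[of e]) simp_all
  qed
qed

lemma paths_to_card: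
  assumes B: "bratteli_diagram B"
  shows finite_paths_to: "v \<in> vertices B n \<Longrightarrow> finite (paths_to B n v)"
    and card_paths_to_Suc: "v \<in> vertices B (Suc n) \<Longrightarrow> card (paths_to B (Suc n) v)
      = (\<Sum>e \<in> {e \<in> edges B n. rng B e = v}. card (paths_to B n (src B e)))"
proof -
  show fin: "finite (paths_to B n v)" if "v \<in> vertices B n" for v n
    using that
  proof (induction n arbitrary: v)
    case (Suc n)
    then show ?case
      using bratteli_diagramD(3,6)[OF B] by (auto simp: paths_to_Suc)
  qed (simp add: paths_to_0)
  assume v: "v \<in> vertices B (Suc n)"
  let ?E = "{e \<in> edges B n. rng B e = v}"
  have "card (paths_to B (Suc n) v)
      = (\<Sum>e \<in> ?E. card ((\<lambda>(u, p). (u, p @ [e])) ` paths_to B n (src B e)))"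
    unfolding paths_to_Suc
    using bratteli_diagramD(3,6)[OF B] fin v by (intro card_UN_disjoint) auto
  also have "\<dots> = (\<Sum>e \<in> ?E. card (paths_to B n (src B e)))"
    by (intro sum.cong card_image) (auto simp: inj_on_def)
  finally show "card (paths_to B (Suc n) v) = (\<Sum>e \<in> ?E. card (paths_to B n (src B e)))" .
qed

lemma card_edges_into:
  assumes "finite {e \<in> edges B n. rng B e = v}" "finite T"
    and "src B ` {e \<in> edges B n. rng B e = v} \<subseteq> T"
  shows "card {e \<in> edges B n. rng B e = v} = (\<Sum>w \<in> T. incidence B n v w)"
proof -
  have "(\<Sum>w \<in> T. incidence B n v w)
      = (\<Sum>w \<in> T. \<Sum>e \<in> {e \<in> {e \<in> edges B n. rng B e = v}. src B e = w}. 1)"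
    by (intro sum.cong) (auto simp: incidence_def intro!: arg_cong[where f = card])
  also have "\<dots> = card {e \<in> edges B n. rng B e = v}"
    unfolding sum.group[OF assms] by simp
  finally show ?thesis ..
qed

text \<open>Only finitely many edges end in \<open>v\<close>, so the row sum over the infinite level
  reduces to a finite sum over their sources, which counts these edges by source.\<close>

lemma card_edges_into_equal_row_sums:
  assumes B: "bratteli_diagram B" and r: "equal_row_sums B r" and v: "v \<in> vertices B (Suc n)"
  shows "card {e \<in> edges B n. rng B e = v} = r n"
proof -
  let ?E = "{e \<in> edges B n. rng B e = v}"
  have fin: "finite ?E" using bratteli_diagramD(6)[OF B v] .
  have "((\<lambda>w. incidence B n v w) has_sum r n) (vertices B n)"
    using r v by (simp add: equal_row_sums_def)
  moreover have "incidence B n v w = 0" if "w \<notin> src B ` ?E" for w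
  proof -
    have "{e \<in> edges B n. src B e = w \<and> rng B e = v} = {}" using that by blast
    then show ?thesis unfolding incidence_def by (simp only: card.empty)
  qed
  then have "((\<lambda>w. incidence B n v w) has_sum r n) (vertices B n)
      \<longleftrightarrow> ((\<lambda>w. incidence B n v w) has_sum r n) (src B ` ?E)"
    using bratteli_diagramD(3)[OF B]
    by (intro has_sum_cong_neutral) auto
  ultimately have "r n = (\<Sum>w \<in> src B ` ?E. incidence B n v w)"
    using has_sum_unique has_sum_finite[OF finite_imageI[OF fin]] by blast
  then show ?thesis using card_edges_into[OF fin finite_imageI[OF fin] order_refl] by simp
qed

text \<open>The number of incoming edges depends only on the level, so the recursion over the last
  edge becomes a product.\<close>

lemma card_paths_to_equal_row_sums:
  assumes "bratteli_diagram B" "equal_row_sums B r" "v \<in> vertices B n"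
  shows "card (paths_to B n v) = (\<Prod>i<n. r i)"
  using assms(3)
proof (induction n arbitrary: v)
  case (Suc n)
  have "card (paths_to B (Suc n) v) = (\<Sum>e \<in> {e \<in> edges B n. rng B e = v}. \<Prod>i<n. r i)"
    unfolding card_paths_to_Suc[OF assms(1) Suc.prems]
    using bratteli_diagramD(3)[OF assms(1)] by (intro sum.cong Suc.IH) auto
  then show ?case
    by (simp add: card_edges_into_equal_row_sums[OF assms(1,2) Suc.prems])
qed (simp add: paths_to_0)

context bratteli_pair begin

lemma incidence_sub: "v \<in> W (Suc n) \<Longrightarrow> w \<in> W n \<Longrightarrow> incidence S n v w = incidence B n v w"
  by (auto simp: incidence_def edges_sub intro!: arg_cong[where f = card])

lemma finite_incidences:
  assumes "finite (W n)" "finite (W (Suc n))"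
  shows "finite {incidence B n v w | v w. v \<in> W (Suc n) \<and> w \<in> W n}"
proof (rule finite_subset)
  show "finite ((\<lambda>(v, w). incidence B n v w) ` (W (Suc n) \<times> W n))" using assms by auto
qed auto

text \<open>Each of the \<open>card (W n)\<close> vertices below sends at least
  \<open>m_bar B W n\<close> edges to \<open>v\<close>, all of them in \<open>S\<close>; each edge
  extends every path to its source.\<close>

lemma card_paths_to_sub_ge:
  assumes "\<And>n. finite (W n)" "v \<in> W n"
  shows "(\<Prod>i<n. m_bar B W i * card (W i)) \<le> card (paths_to S n v)"
  using assms(2)
proof (induction n arbitrary: v)
  case 0
  then show ?case by (simp add: paths_to_0)
next
  case (Suc n)
  let ?E = "{e \<in> edges S n. rng S e = v}"
  have v: "v \<in> vertices S (Suc n)" using Suc.prems by simp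
  have "m_bar B W n \<le> incidence S n v w" if "w \<in> W n" for w
    unfolding m_bar_def incidence_sub[OF Suc.prems that]
    using Suc.prems that by (intro Min_le finite_incidences assms(1)) blast
  then have "m_bar B W n * card (W n) \<le> (\<Sum>w \<in> W n. incidence S n v w)"
    using sum_bounded_below[of "W n" "m_bar B W n" "incidence S n v"] by (simp add: mult.commute)
  also have "\<dots> = card ?E"
    using bratteli_diagramD(6)[OF sub v] assms(1)
    by (intro card_edges_into[symmetric]) (auto simp: edges_sub)
  finally have "(\<Prod>i<Suc n. m_bar B W i * card (W i))
      \<le> (\<Prod>i<n. m_bar B W i * card (W i)) * card ?E" by simp
  also have "\<dots> = (\<Sum>e \<in> ?E. \<Prod>i<n. m_bar B W i * card (W i))" by simp
  also have "\<dots> \<le> card (paths_to S (Suc n) v)"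
    unfolding card_paths_to_Suc[OF sub v]
    by (intro sum_mono Suc.IH) (auto simp: edges_sub)
  finally show ?case .
qed

end

section \<open>Bounding the total mass of the extension\<close>

context bratteli_pair_measure begin

text \<open>The first \<open>n\<close> edges split the set into disjoint tail cylinders, finitely
  many for each endpoint and all of the weight of that endpoint.\<close>

lemma emeasure_tail_from:
  assumes "finite (W n)"
  shows "emeasure extension (tail_from n) = (\<Sum>v \<in> W n. card (paths_to B n v) * weight v)"
proof -
  let ?I = "SIGMA v : W n. paths_to B n v"
  let ?E = "\<lambda>(v, u, p). tail_cylinder u p"
  have path: "finite_path B u p v" "length p = n" "v \<in> W n" if "(v, u, p) \<in> ?I" for v u p
    using that by (auto simp: paths_to_def)
  have fin: "finite (paths_to B n v)" if "v \<in> W n" for v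
    using finite_paths_to[OF diagram] that W_subset by blast
  have "tail_from n = \<Union> (?E ` ?I)"
  proof
    show "tail_from n \<subseteq> \<Union> (?E ` ?I)"
    proof
      fix x assume "x \<in> tail_from n"
      then have x: "x \<in> path_space B" "\<And>i. i \<ge> n \<Longrightarrow> x i \<in> edges S i" by (auto simp: tail_from_def)
      then have "(src B (x n), src B (x 0), map x [0..<n]) \<in> ?I"
        using finite_path_path[OF diagram x(1), of n] x(2)[of n] by (simp add: paths_to_def edges_sub)
      with mem_tail_cylinder_path[OF x] show "x \<in> \<Union> (?E ` ?I)" by blast
    qed
    show "\<Union> (?E ` ?I) \<subseteq> tail_from n"
      using path(2) by (auto simp: tail_cylinder_def tail_from_def cylinder_def)
  qed
  also have "emeasure extension (\<Union> (?E ` ?I)) = (\<Sum>i \<in> ?I. emeasure extension (?E i))"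
  proof (rule sum_emeasure[symmetric])
    show "?E ` ?I \<subseteq> sets extension" using path tail_cylinder_sets by fastforce
    show "disjoint_family_on ?E ?I"
      unfolding disjoint_family_on_def
    proof (intro ballI impI)
      fix a b assume ab: "a \<in> ?I" "b \<in> ?I" "a \<noteq> b"
      obtain v u p v' u' p' where eq: "a = (v, u, p)" "b = (v', u', p')" by (metis prod.collapse)
      show "?E a \<inter> ?E b = {}"
        using tail_cylinder_disjoint[of u p v u' p' v'] path[of v u p] path[of v' u' p'] ab eq by auto
    qed
    show "finite ?I" using assms fin by auto
  qed
  also have "\<dots> = (\<Sum>(v, q) \<in> ?I. weight v)"
    using emeasure_extension_tail_cylinder[OF path(1)] path(2,3) by (intro sum.cong) auto
  also have "\<dots> = (\<Sum>v \<in> W n. card (paths_to B n v) * weight v)"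
    using assms fin by (subst sum.Sigma[symmetric]) auto
  finally show ?thesis .
qed

text \<open>The cylinders of length \<open>n\<close> partition \<open>path_space S\<close>, which
  has mass one. This normalisation is what bounds the weights.\<close>

lemma sum_weight:
  assumes "finite (W n)"
  shows "(\<Sum>v \<in> W n. card (paths_to S n v) * weight v) = 1"
proof -
  interpret prob_space \<nu> by (rule prob)
  let ?I = "SIGMA v : W n. paths_to S n v"
  let ?E = "\<lambda>(v, u, p). cylinder S u p"
  have path: "finite_path S u p v" "length p = n" "v \<in> W n" if "(v, u, p) \<in> ?I" for v u p
    using that by (auto simp: paths_to_def)
  have fin: "finite (paths_to S n v)" if "v \<in> W n" for v
    using finite_paths_to[OF sub] that by simp
  have "(\<Sum>v \<in> W n. card (paths_to S n v) * weight v) = (\<Sum>(v, q) \<in> ?I. weight v)"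
    using assms fin by (subst sum.Sigma[symmetric]) auto
  also have "\<dots> = (\<Sum>i \<in> ?I. emeasure \<nu> (?E i))"
    using emeasure_nu_cylinder[OF path(1)] by (intro sum.cong) auto
  also have "\<dots> = emeasure \<nu> (\<Union> (?E ` ?I))"
  proof (rule sum_emeasure)
    show "?E ` ?I \<subseteq> sets \<nu>" using path cylinder_sets_nu by fastforce
    show "disjoint_family_on ?E ?I"
      unfolding disjoint_family_on_def
    proof (intro ballI impI)
      fix a b assume ab: "a \<in> ?I" "b \<in> ?I" "a \<noteq> b"
      obtain v u p v' u' p' where eq: "a = (v, u, p)" "b = (v', u', p')" by (metis prod.collapse)
      \<comment> \<open>Cylinders of \<open>S\<close> are tail cylinders of \<open>B\<close>, so the
        disjointness of the latter applies.\<close>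
      show "?E a \<inter> ?E b = {}"
        using tail_cylinder_disjoint[of u p v u' p' v'] cylinder_sub_eq finite_path_sub
          path[of v u p] path[of v' u' p'] ab eq by auto
    qed
    show "finite ?I" using assms fin by auto
  qed
  also have "\<Union> (?E ` ?I) = space \<nu>"
  proof
    show "\<Union> (?E ` ?I) \<subseteq> space \<nu>" by (auto simp: space_nu cylinder_def)
    show "space \<nu> \<subseteq> \<Union> (?E ` ?I)"
    proof
      fix x assume "x \<in> space \<nu>"
      then have x: "x \<in> path_space S" by (simp add: space_nu)
      then have "(src B (x n), src B (x 0), map x [0..<n]) \<in> ?I"
        using finite_path_path[OF sub x, of n] by (simp add: paths_to_def path_space_sub edges_sub)
      with mem_cylinder_path[OF x, of n] show "x \<in> \<Union> (?E ` ?I)" by auto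
    qed
  qed
  finally show ?thesis by (simp add: emeasure_space_1)
qed

text \<open>The mass is \<open>?R * ?s\<close>, as \<open>?R\<close> is the common number of paths
  of \<open>B\<close> to a vertex of level \<open>n\<close>. Since \<open>?D\<close> bounds the
  number of paths of \<open>S\<close> to such a vertex in \<open>W n\<close> from below,
  normalisation gives \<open>?D * ?s \<le> 1\<close>.\<close>

lemma emeasure_tail_from_le:
  assumes fin: "\<And>n. finite (W n)" and r: "equal_row_sums B r"
    and pos: "\<And>i. 0 < m_bar B W i * card (W i)"
  shows "emeasure extension (tail_from n)
    \<le> ennreal (\<Prod>i<n. real (r i) / (real (m_bar B W i) * real (card (W i))))"
proof -
  let ?R = "\<Prod>i<n. r i" and ?D = "\<Prod>i<n. m_bar B W i * card (W i)"
  let ?s = "\<Sum>v \<in> W n. weight v"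
  have D: "0 < ?D" using pos by (intro prod_pos) auto
  \<comment> \<open>The quotient is formed in the reals, where the assumed products live;
    multiplying back by a positive \<open>b\<close> is exact.\<close>
  have ratio: "of_nat a = ennreal (real a / real b) * of_nat b" if "0 < b" for a b :: nat
    using that by (simp add: ennreal_of_nat_eq_real_of_nat flip: ennreal_mult)
  have "of_nat ?D * ?s = (\<Sum>v \<in> W n. of_nat ?D * weight v)" by (rule sum_distrib_left)
  also have "\<dots> \<le> (\<Sum>v \<in> W n. card (paths_to S n v) * weight v)"
    using card_paths_to_sub_ge[OF fin] by (intro sum_mono mult_right_mono of_nat_mono) auto
  finally have D_le: "of_nat ?D * ?s \<le> 1" using sum_weight[OF fin] by simp
  have "emeasure extension (tail_from n) = (\<Sum>v \<in> W n. of_nat ?R * weight v)"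
    unfolding emeasure_tail_from[OF fin]
    using card_paths_to_equal_row_sums[OF diagram r subsetD[OF W_subset]] by (intro sum.cong) simp_all
  also have "\<dots> = of_nat ?R * ?s" by (rule sum_distrib_left[symmetric])
  also have "of_nat ?R = ennreal (real ?R / real ?D) * of_nat ?D"
    using ratio[OF D] .
  also have "ennreal (real ?R / real ?D) * of_nat ?D * ?s \<le> ennreal (real ?R / real ?D)"
    using mult_left_mono[OF D_le, of "ennreal (real ?R / real ?D)"] by (simp add: mult.assoc)
  also have "real ?R / real ?D = (\<Prod>i<n. real (r i) / (real (m_bar B W i) * real (card (W i))))"
    by (simp add: prod_dividef)
  finally show ?thesis .
qed

text \<open>A convergent sequence of products is bounded, and one bound for all sets
  \<open>tail_from n\<close> with positive \<open>n\<close> passes to their increasing union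
  \<open>X\<close>.\<close>

lemma emeasure_extension_finite:
  assumes "\<And>n. finite (W n)" "equal_row_sums B r"
    and "\<And>i. 0 < m_bar B W i * card (W i)"
    and "convergent (\<lambda>n. \<Prod>i\<le>n. real (r i) / (real (m_bar B W i) * real (card (W i))))"
  shows "emeasure extension X < \<infinity>"
proof -
  let ?P = "\<lambda>n. \<Prod>i\<le>n. real (r i) / (real (m_bar B W i) * real (card (W i)))"
  obtain K where K: "\<And>n. norm (?P n) \<le> K"
    using BseqE[OF convergent_imp_Bseq[OF assms(4)]] by metis
  have sets: "tail_from n \<in> sets extension" for n
    unfolding sets_extension
  proof (intro sigma_sets_Union_tail_cylinders)
    fix x assume "x \<in> tail_from n"
    then have x: "x \<in> path_space B" "\<And>i. i \<ge> n \<Longrightarrow> x i \<in> edges S i" by (auto simp: tail_from_def)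
    have "tail_cylinder (src B (x 0)) (map x [0..<n]) \<subseteq> tail_from n"
      by (auto simp: tail_cylinder_def tail_from_def cylinder_def)
    with mem_tail_cylinder_path[OF x] mem_tail_cylinders_path[OF x]
    show "\<exists>E \<in> tail_cylinders. x \<in> E \<and> E \<subseteq> tail_from n" by blast
  qed
  \<comment> \<open>The assumed products run over \<open>i \<le> n\<close> and so have at least one
    factor, whereas the bound for \<open>tail_from n\<close> has \<open>n\<close> factors; the
    exhaustion therefore begins at level one.\<close>
  have "emeasure extension X = (SUP k. emeasure extension (tail_from (1 + k)))"
    unfolding Union_tail_from[of 1, symmetric]
    using sets incseq_tail_from
    by (intro SUP_emeasure_incseq[symmetric]) (auto simp: incseq_def)
  also have "\<dots> \<le> ennreal K"
  proof (rule SUP_least)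
    fix k
    have "emeasure extension (tail_from (1 + k)) \<le> ennreal (?P k)"
      using emeasure_tail_from_le[OF assms(1-3), of "1 + k"] by (simp add: lessThan_Suc_atMost)
    also have "\<dots> \<le> ennreal K" using K[of k] by (intro ennreal_leI) simp
    finally show "emeasure extension (tail_from (1 + k)) \<le> ennreal K" .
  qed
  finally show ?thesis by (simp add: order_le_less_trans)
qed

end

theorem theorem4p4:
  fixes B :: "('v, 'e) diagram"
    and W :: "nat \<Rightarrow> 'v set"
    and r :: "nat \<Rightarrow> nat"
  assumes "generalized_bratteli_diagram B"
    and "equal_row_sums B r"
    and "\<And>n. W n \<subset> vertices B n"
    and "\<And>n. finite (W n)"
    and "standard_bratteli_diagram (vertex_subdiagram B W)"
    and "simple_diagram (vertex_subdiagram B W)"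
    and "\<And>n. n \<ge> 1 \<Longrightarrow> W_prime B W n \<noteq> {}"
    and "\<And>n. n \<ge> 1 \<Longrightarrow> m_prime B W n > 0"
    and "bounded {real (M_prime B W n) / real (m_prime B W n) | n. n \<ge> 1}"
    and "convergent (\<lambda>n. \<Prod>i\<le>n. real (r i) / (real (m_bar B W i) * real (card (W i))))"
  shows "\<forall>\<nu>. prob_space \<nu> \<and> tail_invariant_measure (vertex_subdiagram B W) \<nu> \<longrightarrow>
    emeasure (measure_extension B (vertex_subdiagram B W) \<nu>)
      (extension_space B (vertex_subdiagram B W)) < \<infinity>"
proof (intro allI impI)
  fix \<nu> assume nu: "prob_space \<nu> \<and> tail_invariant_measure (vertex_subdiagram B W) \<nu>"
  interpret bratteli_pair_measure B W \<nu>
  proof (intro bratteli_pair_measure.intro bratteli_pair.intro bratteli_pair_measure_axioms.intro)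
    show "W n \<subseteq> vertices B n" for n using assms(3)[of n] by (rule psubset_imp_subset)
  qed (use assms(1,5) nu in \<open>simp_all add: standard_bratteli_diagram_def\<close>)
  \<comment> \<open>The weights on each level, counted with multiplicity, sum to one, which an empty
    sum cannot do.\<close>
  have ne: "W n \<noteq> {}" for n
    using sum_weight[OF assms(4), of n] by auto
  have "0 < m_bar B W n * card (W n)" for n
  proof -
    \<comment> \<open>The minimum over a finite nonempty set is attained, so simplicity of the
      subdiagram makes it positive.\<close>
    have "m_bar B W n \<in> {incidence B n v w | v w. v \<in> W (Suc n) \<and> w \<in> W n}"
      unfolding m_bar_def using ne[of n] ne[of "Suc n"]
      by (intro Min_in finite_incidences assms(4)) blast
    then obtain v w where vw: "m_bar B W n = incidence B n v w" "v \<in> W (Suc n)" "w \<in> W n" by blast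
    then have "0 < m_bar B W n"
      using assms(6) unfolding simple_diagram_def vw(1) incidence_sub[OF vw(2,3), symmetric]
      using vw(2,3) by simp
    then show ?thesis using ne[of n] assms(4)[of n] by (simp add: card_gt_0_iff)
  qed
  from emeasure_extension_finite[OF assms(4,2) this assms(10)]
  show "emeasure (measure_extension B (vertex_subdiagram B W) \<nu>)
      (extension_space B (vertex_subdiagram B W)) < \<infinity>"
    by (simp add: measure_extension_eq)
qed

end
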